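(* Let $m\ge 1$ be an integer, let $\ell$ be an odd integer, and let $J$, $A$, $B$, $C$, $s$, $u$, $\phi$, $\varphi$ be as defined in the context. Let $i,j,k,a,b,c\in\mathbb{Z}$. Then in $J$ $$(A^iB^jC^k)(A^aB^bC^c)=A^{e_A}B^{e_B}C^{e_C}A^{\xi_2},$$ where $$e_A=i+a+2s\ell\{j\phi(a)-ka\},$$ $$e_B=j+b+2s\ell\{kb-jab-\phi(j)a\},$$ $$e_C=k+c-ja+2s\ell\{jka-\phi(j+1)\phi(a)\},$$ and $\xi_2=\xi_2(j,k,a,b)$ is given by $$\xi_2(j,k,a,b)=2u\ell^2\{\phi(j)\phi(a)(-2j+2a-2b+5)-2\phi(j)a(j+k+b-1)-j\phi(a)(4k-2a+1)+2\phi(k)(a-b)-ka(j-2)-2j(ab+\varphi(a+1))+(3a+1)a\varphi(j)\}.$$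
   Context: Notation: $[a,b]=a^{-1}b^{-1}ab$, $b^a=a^{-1}ba$ for group elements, $\alpha=1+2^m\ell$, $s=2^{m-1}$, $u=s^2$. The group is $$J=\langle A,B\mid A^{[A,B]}=A^{\alpha},\ B^{[B,A]}=B^{\alpha},\ A^{2^{3m-1}}=B^{2^{3m-1}}=1\rangle,\qquad C=[A,B].$$ For $n\in\mathbb{Z}$, $\phi(n)=\frac{(n-1)n}{2}$ and $\varphi(n)=\frac{n(n-1)(n-2)}{6}$. *)

theory Defs
  imports "HOL-Algebra.Coset"
begin

text \<open>A word is a list of letters; the letter \<open>(x, True)\<close> stands for the generator \<open>x\<close>
  and \<open>(x, False)\<close> for its inverse. All elements of the type \<open>'g\<close> are generators.\<close>

type_synonym 'g word = "('g \<times> bool) list"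

inductive free_eq :: "'g word \<Rightarrow> 'g word \<Rightarrow> bool" where
  cancel: "free_eq (v @ [(x, e), (x, \<not> e)] @ w) (v @ w)"
| refl: "free_eq v v"
| sym: "free_eq v w \<Longrightarrow> free_eq w v"
| trans: "free_eq v w \<Longrightarrow> free_eq w z \<Longrightarrow> free_eq v z"

definition free_rel :: "('g word \<times> 'g word) set" where
  "free_rel = {(v, w). free_eq v w}"

definition free_group :: "'g word set monoid" where
  "free_group =
    \<lparr>carrier = UNIV // free_rel,
     mult = (\<lambda>V W. \<Union>v\<in>V. \<Union>w\<in>W. free_rel `` {v @ w}),
     one = free_rel `` {[]}\<rparr>"

definition free_gen :: "'g \<Rightarrow> 'g word set" where
  "free_gen x = free_rel `` {[(x, True)]}"

definition normal_closure :: "('a, 'b) monoid_scheme \<Rightarrow> 'a set \<Rightarrow> 'a set" where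
  "normal_closure G R = \<Inter>{N. N \<lhd> G \<and> R \<subseteq> N}"

definition pres_group :: "'g word set set \<Rightarrow> 'g word set set monoid" where
  "pres_group R = free_group Mod normal_closure free_group R"

definition pres_gen :: "'g word set set \<Rightarrow> 'g \<Rightarrow> 'g word set set" where
  "pres_gen R x = normal_closure free_group R #>\<^bsub>free_group\<^esub> free_gen x"

lemma equiv_free_rel: "equiv UNIV free_rel"
  by (intro equivI refl_onI symI transI)
     (auto simp: free_rel_def intro: free_eq.refl free_eq.sym free_eq.trans)

lemma free_eq_append_left: "free_eq v w \<Longrightarrow> free_eq (p @ v) (p @ w)"
proof (induction rule: free_eq.induct)
  case (cancel v x e w)
  show ?case using free_eq.cancel[of "p @ v" x e w] by simp
qed (auto intro: free_eq.refl free_eq.sym free_eq.trans)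

lemma free_eq_append_right: "free_eq v w \<Longrightarrow> free_eq (v @ p) (w @ p)"
proof (induction rule: free_eq.induct)
  case (cancel v x e w)
  show ?case using free_eq.cancel[of v x e "w @ p"] by simp
qed (auto intro: free_eq.refl free_eq.sym free_eq.trans)

lemma free_class_eq_iff: "free_rel `` {v} = free_rel `` {w} \<longleftrightarrow> free_eq v w"
  using eq_equiv_class_iff[OF equiv_free_rel, of v w] by (simp add: free_rel_def)

lemma free_mult_class:
  "free_rel `` {v} \<otimes>\<^bsub>free_group\<^esub> free_rel `` {w} = free_rel `` {v @ w}"
proof -
  have eq: "free_rel `` {v' @ w'} = free_rel `` {v @ w}"
    if "v' \<in> free_rel `` {v}" "w' \<in> free_rel `` {w}" for v' w'
  proof -
    have "free_eq v v'" "free_eq w w'" using that by (simp_all add: free_rel_def)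
    then show ?thesis
      unfolding free_class_eq_iff
      by (meson free_eq.sym free_eq.trans free_eq_append_left free_eq_append_right)
  qed
  have ne: "free_rel `` {v} \<noteq> {}" for v :: "'a word"
    by (auto simp: free_rel_def intro: free_eq.refl)
  have "free_rel `` {v} \<otimes>\<^bsub>free_group\<^esub> free_rel `` {w} =
      (\<Union>v'\<in>free_rel `` {v}. \<Union>w'\<in>free_rel `` {w}. free_rel `` {v' @ w'})"
    by (simp add: free_group_def)
  also have "\<dots> = (\<Union>v'\<in>free_rel `` {v}. \<Union>w'\<in>free_rel `` {w}. free_rel `` {v @ w})"
    by (intro SUP_cong HOL.refl eq)
  also have "\<dots> = free_rel `` {v @ w}"
    by (simp only: UN_constant ne if_False)
  finally show ?thesis .
qed

lemma free_class_carrier [simp]: "free_rel `` {v} \<in> carrier free_group"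
  by (simp add: free_group_def quotientI)

lemma free_carrier_cases:
  assumes "V \<in> carrier free_group"
  obtains v where "V = free_rel `` {v}"
  using assms by (auto simp: free_group_def elim: quotientE)

lemma free_one: "\<one>\<^bsub>free_group\<^esub> = free_rel `` {[]}"
  by (simp add: free_group_def)

lemma free_mult_closed:
  assumes "V \<in> carrier free_group" "W \<in> carrier free_group"
  shows "V \<otimes>\<^bsub>free_group\<^esub> W \<in> carrier free_group"
proof -
  obtain v w where "V = free_rel `` {v}" "W = free_rel `` {w}"
    using assms free_carrier_cases by metis
  then show ?thesis by (simp add: free_mult_class)
qed

lemma free_mult_assoc:
  assumes "V \<in> carrier free_group" "W \<in> carrier free_group" "Z \<in> carrier free_group"
  shows "V \<otimes>\<^bsub>free_group\<^esub> W \<otimes>\<^bsub>free_group\<^esub> Z = V \<otimes>\<^bsub>free_group\<^esub> (W \<otimes>\<^bsub>free_group\<^esub> Z)"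
proof -
  obtain v w z where "V = free_rel `` {v}" "W = free_rel `` {w}" "Z = free_rel `` {z}"
    using assms free_carrier_cases by metis
  then show ?thesis by (simp add: free_mult_class)
qed

lemma free_mult_one:
  assumes "V \<in> carrier free_group"
  shows "free_rel `` {[]} \<otimes>\<^bsub>free_group\<^esub> V = V"
proof -
  obtain v where "V = free_rel `` {v}"
    using assms free_carrier_cases by metis
  then show ?thesis by (simp add: free_mult_class)
qed

lemma free_left_inverse:
  "free_eq (rev (map (\<lambda>(x, e). (x, \<not> e)) v) @ v) []"
proof (induction v)
  case Nil
  show ?case by (simp add: free_eq.refl)
next
  case (Cons a v)
  obtain x e where a: "a = (x, e)" by force
  have "free_eq (rev (map (\<lambda>(x, e). (x, \<not> e)) v) @ [(x, \<not> e), (x, \<not> \<not> e)] @ v)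
                (rev (map (\<lambda>(x, e). (x, \<not> e)) v) @ v)"
    by (rule free_eq.cancel)
  with Cons.IH show ?case by (auto simp: a intro: free_eq.trans)
qed

lemma group_free_group: "group free_group"
proof (rule groupI)
  fix V assume "V \<in> carrier (free_group :: 'a word set monoid)"
  then obtain v where v: "V = free_rel `` {v}" by (rule free_carrier_cases)
  show "\<exists>W\<in>carrier free_group. W \<otimes>\<^bsub>free_group\<^esub> V = \<one>\<^bsub>free_group\<^esub>"
    by (rule bexI[of _ "free_rel `` {rev (map (\<lambda>(x, e). (x, \<not> e)) v)}"])
       (simp_all add: v free_mult_class free_one free_class_eq_iff free_left_inverse)
qed (simp_all add: free_one free_mult_assoc free_mult_closed free_mult_one)

lemma free_gen_carrier [simp]: "free_gen x \<in> carrier free_group"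
  by (simp add: free_gen_def)

lemma (in group) normal_closure_normal:
  assumes "R \<subseteq> carrier G"
  shows "normal_closure G R \<lhd> G"
proof (rule normal_invI)
  have "carrier G \<lhd> G"
    by (rule normal_invI) (auto intro: subgroup_self)
  then have ne: "{N. N \<lhd> G \<and> R \<subseteq> N} \<noteq> {}" using assms by blast
  show "subgroup (normal_closure G R) G"
    unfolding normal_closure_def
    by (rule subgroups_Inter) (use ne in \<open>auto intro: normal_imp_subgroup\<close>)
next
  fix x h assume "x \<in> carrier G" "h \<in> normal_closure G R"
  then show "x \<otimes> h \<otimes> inv x \<in> normal_closure G R"
    by (auto simp: normal_closure_def intro: normal.inv_op_closed2)
qed

lemma normal_closure_incl: "R \<subseteq> normal_closure G R"
  by (auto simp: normal_closure_def)

lemma group_pres_group: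
  assumes "R \<subseteq> carrier free_group"
  shows "group (pres_group R)"
  unfolding pres_group_def
  by (intro normal.factorgroup_is_group group.normal_closure_normal group_free_group assms)

lemma pres_hom:
  assumes "R \<subseteq> carrier free_group"
  shows "(\<lambda>V. normal_closure free_group R #>\<^bsub>free_group\<^esub> V) \<in> hom free_group (pres_group R)"
  unfolding pres_group_def
  by (intro normal.r_coset_hom_Mod group.normal_closure_normal group_free_group assms)

lemma pres_relator:
  assumes "R \<subseteq> carrier free_group" "r \<in> R"
  shows "normal_closure free_group R #>\<^bsub>free_group\<^esub> r = \<one>\<^bsub>pres_group R\<^esub>"
proof -
  interpret group "free_group :: 'a word set monoid" by (rule group_free_group)
  have "subgroup (normal_closure free_group R) free_group"
    using normal_closure_normal[OF assms(1)] by (rule normal_imp_subgroup)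
  then show ?thesis
    unfolding pres_group_def
    using coset_join2 assms normal_closure_incl[of R free_group] by (metis one_FactGroup subsetD)
qed

lemma pres_gen_carrier [simp]: "R \<subseteq> carrier free_group \<Longrightarrow> pres_gen R x \<in> carrier (pres_group R)"
  unfolding pres_gen_def by (rule hom_in_carrier[OF pres_hom]) auto

definition comm :: "('a, 'b) monoid_scheme \<Rightarrow> 'a \<Rightarrow> 'a \<Rightarrow> 'a" where
  "comm G x y = inv\<^bsub>G\<^esub> x \<otimes>\<^bsub>G\<^esub> inv\<^bsub>G\<^esub> y \<otimes>\<^bsub>G\<^esub> x \<otimes>\<^bsub>G\<^esub> y"

text \<open>\<open>conj_by G y x\<close> is the conjugate written \<open>y\<^sup>x\<close>.\<close>

definition conj_by :: "('a, 'b) monoid_scheme \<Rightarrow> 'a \<Rightarrow> 'a \<Rightarrow> 'a" where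
  "conj_by G y x = inv\<^bsub>G\<^esub> x \<otimes>\<^bsub>G\<^esub> y \<otimes>\<^bsub>G\<^esub> x"

datatype gen = genA | genB

definition alpha :: "nat \<Rightarrow> int \<Rightarrow> int" where
  "alpha m l = 1 + 2 ^ m * l"

definition J_relators :: "nat \<Rightarrow> int \<Rightarrow> gen word set set" where
  "J_relators m l =
    (let F = free_group; a = free_gen genA; b = free_gen genB in
     {conj_by F a (comm F a b) \<otimes>\<^bsub>F\<^esub> inv\<^bsub>F\<^esub> (a [^]\<^bsub>F\<^esub> alpha m l),
      conj_by F b (comm F b a) \<otimes>\<^bsub>F\<^esub> inv\<^bsub>F\<^esub> (b [^]\<^bsub>F\<^esub> alpha m l),
      a [^]\<^bsub>F\<^esub> (2 ^ (3 * m - 1) :: nat),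
      b [^]\<^bsub>F\<^esub> (2 ^ (3 * m - 1) :: nat)})"

definition J_group :: "nat \<Rightarrow> int \<Rightarrow> gen word set set monoid" where
  "J_group m l = pres_group (J_relators m l)"

definition J_A :: "nat \<Rightarrow> int \<Rightarrow> gen word set set" where
  "J_A m l = pres_gen (J_relators m l) genA"

definition J_B :: "nat \<Rightarrow> int \<Rightarrow> gen word set set" where
  "J_B m l = pres_gen (J_relators m l) genB"

lemma (in group) comm_closed:
  "x \<in> carrier G \<Longrightarrow> y \<in> carrier G \<Longrightarrow> comm G x y \<in> carrier G"
  by (simp add: comm_def)

lemma (in group) conj_by_closed:
  "x \<in> carrier G \<Longrightarrow> y \<in> carrier G \<Longrightarrow> conj_by G y x \<in> carrier G"
  by (simp add: conj_by_def)

lemma (in group) eq_of_mult_inv_eq_one: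
  assumes "x \<in> carrier G" "y \<in> carrier G" "x \<otimes> inv y = \<one>"
  shows "x = y"
  using inv_equality[of x "inv y"] assms by simp

lemma J_relators_carrier: "J_relators m l \<subseteq> carrier free_group"
proof -
  interpret group "free_group :: gen word set monoid" by (rule group_free_group)
  show ?thesis
    by (simp add: J_relators_def Let_def comm_closed conj_by_closed)
qed

lemma group_J_group: "group (J_group m l)"
  unfolding J_group_def by (rule group_pres_group[OF J_relators_carrier])

lemma J_A_carrier [simp]: "J_A m l \<in> carrier (J_group m l)"
  and J_B_carrier [simp]: "J_B m l \<in> carrier (J_group m l)"
  by (simp_all add: J_group_def J_A_def J_B_def J_relators_carrier)

lemma J_relations:
  fixes m :: nat and l :: int
  defines "J \<equiv> J_group m l" and "A \<equiv> J_A m l" and "B \<equiv> J_B m l"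
  shows "conj_by J A (comm J A B) = A [^]\<^bsub>J\<^esub> alpha m l"
    and "conj_by J B (comm J B A) = B [^]\<^bsub>J\<^esub> alpha m l"
    and "A [^]\<^bsub>J\<^esub> (2 ^ (3 * m - 1) :: nat) = \<one>\<^bsub>J\<^esub>"
    and "B [^]\<^bsub>J\<^esub> (2 ^ (3 * m - 1) :: nat) = \<one>\<^bsub>J\<^esub>"
proof -
  define F where "F = (free_group :: gen word set monoid)"
  define a where "a = free_gen genA"
  define b where "b = free_gen genB"
  define q where "q = (\<lambda>V. normal_closure F (J_relators m l) #>\<^bsub>F\<^esub> V)"
  have hom: "q \<in> hom F J"
    unfolding q_def F_def J_def J_group_def by (rule pres_hom[OF J_relators_carrier])
  interpret F: group F unfolding F_def by (rule group_free_group)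
  interpret J: group J unfolding J_def by (rule group_J_group)
  interpret q: group_hom F J q by unfold_locales (rule hom)
  have ab [simp]: "a \<in> carrier F" "b \<in> carrier F" by (simp_all add: a_def b_def F_def)
  have AB: "A = q a" "B = q b"
    by (simp_all add: A_def B_def J_A_def J_B_def pres_gen_def q_def F_def a_def b_def)
  have cl [simp]: "comm F x y \<in> carrier F" "conj_by F x y \<in> carrier F"
    if "x \<in> carrier F" "y \<in> carrier F" for x y
    using that by (simp_all add: F.comm_closed F.conj_by_closed)
  have q_comm: "q (comm F x y) = comm J (q x) (q y)"
    and q_conj: "q (conj_by F x y) = conj_by J (q x) (q y)"
    if "x \<in> carrier F" "y \<in> carrier F" for x y
    using that by (simp_all add: comm_def conj_by_def)
  have rel: "q r = \<one>\<^bsub>J\<^esub>" if "r \<in> J_relators m l" for r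
    unfolding q_def F_def J_def J_group_def by (rule pres_relator[OF J_relators_carrier that])
  have "q (conj_by F a (comm F a b) \<otimes>\<^bsub>F\<^esub> inv\<^bsub>F\<^esub> (a [^]\<^bsub>F\<^esub> alpha m l)) = \<one>\<^bsub>J\<^esub>"
    by (rule rel) (simp add: J_relators_def Let_def F_def a_def b_def)
  then have "conj_by J A (comm J A B) \<otimes>\<^bsub>J\<^esub> inv\<^bsub>J\<^esub> (A [^]\<^bsub>J\<^esub> alpha m l) = \<one>\<^bsub>J\<^esub>"
    by (simp add: q_comm q_conj q.hom_int_pow AB)
  then show "conj_by J A (comm J A B) = A [^]\<^bsub>J\<^esub> alpha m l"
    by (rule J.eq_of_mult_inv_eq_one[rotated 2]) (simp_all add: AB J.comm_closed J.conj_by_closed)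
  have "q (conj_by F b (comm F b a) \<otimes>\<^bsub>F\<^esub> inv\<^bsub>F\<^esub> (b [^]\<^bsub>F\<^esub> alpha m l)) = \<one>\<^bsub>J\<^esub>"
    by (rule rel) (simp add: J_relators_def Let_def F_def a_def b_def)
  then have "conj_by J B (comm J B A) \<otimes>\<^bsub>J\<^esub> inv\<^bsub>J\<^esub> (B [^]\<^bsub>J\<^esub> alpha m l) = \<one>\<^bsub>J\<^esub>"
    by (simp add: q_comm q_conj q.hom_int_pow AB)
  then show "conj_by J B (comm J B A) = B [^]\<^bsub>J\<^esub> alpha m l"
    by (rule J.eq_of_mult_inv_eq_one[rotated 2]) (simp_all add: AB J.comm_closed J.conj_by_closed)
  have "q (a [^]\<^bsub>F\<^esub> (2 ^ (3 * m - 1) :: nat)) = \<one>\<^bsub>J\<^esub>"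
    by (rule rel) (simp add: J_relators_def Let_def F_def a_def b_def)
  then show "A [^]\<^bsub>J\<^esub> (2 ^ (3 * m - 1) :: nat) = \<one>\<^bsub>J\<^esub>"
    by (simp add: q.hom_nat_pow AB)
  have "q (b [^]\<^bsub>F\<^esub> (2 ^ (3 * m - 1) :: nat)) = \<one>\<^bsub>J\<^esub>"
    by (rule rel) (simp add: J_relators_def Let_def F_def a_def b_def)
  then show "B [^]\<^bsub>J\<^esub> (2 ^ (3 * m - 1) :: nat) = \<one>\<^bsub>J\<^esub>"
    by (simp add: q.hom_nat_pow AB)
qed

text \<open>Both divisions are exact: 2 divides a product of two consecutive integers and
  6 a product of three.\<close>

definition phi :: "int \<Rightarrow> int" where
  "phi n = (n - 1) * n div 2"

definition varphi :: "int \<Rightarrow> int" where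
  "varphi n = n * (n - 1) * (n - 2) div 6"

definition xi2 :: "int \<Rightarrow> int \<Rightarrow> int \<Rightarrow> int \<Rightarrow> int \<Rightarrow> int \<Rightarrow> int" where
  "xi2 u l j k a b = 2 * u * l ^ 2 *
    (phi j * phi a * (- 2 * j + 2 * a - 2 * b + 5)
     - 2 * phi j * a * (j + k + b - 1)
     - j * phi a * (4 * k - 2 * a + 1)
     + 2 * phi k * (a - b)
     - k * a * (j - 2)
     - 2 * j * (a * b + varphi (a + 1))
     + (3 * a + 1) * a * varphi j)"

end

theory Submission
  imports Defs
begin

text \<open>
  Put \<open>h = s * l\<close>, so that \<open>\<alpha> = 1 + 2 * h\<close> and the exponent
  \<open>N = 2 ^ (3 * m - 1)\<close> killing the generators divides \<open>4 * h^3\<close>. The argument rests on the three rewriting rules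
  \<open>A C = C A^\<alpha>\<close>, \<open>C B = B^\<alpha> C\<close>, \<open>A B = B A C\<close> (locale \<open>macdonald_pair\<close>), which are symmetric
  under exchanging \<open>A\<close> with \<open>B\<close> and \<open>C\<close> with its inverse. Since \<open>(2 * h)^3\<close> annihilates \<open>A\<close> and
  \<open>B\<close>, the binomial expansion of \<open>\<alpha>^k\<close> stops after its quadratic term, and the rules extend to
  powers with polynomial exponents; \<open>phi\<close> and \<open>varphi\<close> are the binomial coefficients that occur.

  The point is that the quadratic terms all lie in one small central subgroup. Conjugating \<open>A B = B A C\<close> by \<open>C\<close> changes the exponents of \<open>A\<close> and \<open>B\<close> but not
  the commutator; comparing the two forms of the relation (\<open>key_relation\<close>) gives
  \<open>central_powers\<close>: \<open>A^(2h\<^sup>2)\<close> is central, \<open>B^(2h\<^sup>2)\<close> is its inverse, and \<open>C^(2h\<^sup>2)\<close> is its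
  \<open>h\<close>-th power.

  Write \<open>\<zeta> = A^(2h\<^sup>2)\<close>, so \<open>\<zeta>^(2h) = 1\<close>. Every word now has a form \<open>A^x B^y C^z \<zeta>^w\<close>, where a
  change of \<open>x\<close>, \<open>y\<close> or \<open>z\<close> by a multiple of \<open>2h\<^sup>2\<close> is a carry into \<open>w\<close>, and \<open>w\<close> matters
  only modulo \<open>2h\<close> (\<open>nf_cong\<close>). Multiplying such a word by \<open>A\<close> on the right is
  \<open>nf_mult_A\<close>; induction on \<open>a\<close> then collects \<open>B^j A^a\<close> (\<open>B_pow_A_pow\<close>), and moving the powers
  of \<open>C\<close> to the right gives the product of two arbitrary words (\<open>collection_formula\<close>). The exponent
  \<open>\<xi>\<^sub>2\<close> is \<open>2h\<^sup>2\<close> times the accumulated power of \<open>\<zeta>\<close>.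
\<close>

section \<open>Binomial coefficients and induction over the integers\<close>

lemma phi_double: "2 * phi n = n * n - n"
proof -
  have "even ((n - 1) * n)" by simp
  then have "2 * phi n = (n - 1) * n" unfolding phi_def by (metis dvd_mult_div_cancel)
  then show ?thesis by (simp add: algebra_simps)
qed

lemma varphi_six: "6 * varphi n = n * (n - 1) * (n - 2)"
proof -
  have "2 dvd n * (n - 1) * (n - 2)" by simp
  moreover have "3 dvd n * (n - 1) * (n - 2)"
  proof -
    have "n mod 3 = 0 \<or> n mod 3 = 1 \<or> n mod 3 = 2" by presburger
    then have "3 dvd n \<or> 3 dvd n - 1 \<or> 3 dvd n - 2" by presburger
    then show ?thesis by fastforce
  qed
  ultimately have "2 * 3 dvd n * (n - 1) * (n - 2)" by (intro divides_mult) simp_all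
  then have "6 dvd n * (n - 1) * (n - 2)" by simp
  then show ?thesis unfolding varphi_def by (metis dvd_mult_div_cancel)
qed

lemma phi_zero: "phi 0 = 0"
  by (simp add: phi_def)

lemma phi_Suc: "phi (n + 1) = phi n + n"
  using phi_double[of n] phi_double[of "n + 1"] by (simp add: algebra_simps)

lemma varphi_Suc: "varphi (n + 1) = varphi n + phi n"
  using varphi_six[of n] varphi_six[of "n + 1"] phi_double[of n] by algebra

lemma phi_minus: "phi (- n) = phi n + n"
  using phi_double[of n] phi_double[of "- n"] by algebra

text \<open>An identity between words whose two sides are multiplied by the same group element when the
  exponent increases by 1 holds for all integer exponents as soon as it holds for 0: cancellation
  gives the downward step.\<close>

lemma int_iff_induct:
  fixes k :: int
  assumes "P 0" and "\<And>k. P (k + 1) \<longleftrightarrow> P k"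
  shows "P k"
proof (induction k rule: int_induct[where k = 0])
  case base show ?case by (rule assms(1))
next
  case (step1 i) then show ?case using assms(2)[of i] by simp
next
  case (step2 i) then show ?case using assms(2)[of "i - 1"] by simp
qed

context group
begin

lemma commute_tail:
  assumes "a \<otimes> b = c \<otimes> d"
    and "a \<in> carrier G" "b \<in> carrier G" "c \<in> carrier G" "d \<in> carrier G" "w \<in> carrier G"
  shows "a \<otimes> (b \<otimes> w) = c \<otimes> (d \<otimes> w)"
  using assms by (metis m_assoc)

lemma int_pow_merge:
  fixes i j :: int
  assumes "x \<in> carrier G"
  shows "x [^] i \<otimes> x [^] j = x [^] (i + j)"
    and "w \<in> carrier G \<Longrightarrow> x [^] i \<otimes> (x [^] j \<otimes> w) = x [^] (i + j) \<otimes> w"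
  using assms by (simp_all add: int_pow_mult m_assoc)

lemma int_pow_intertwine:
  fixes k :: int
  assumes "x \<otimes> y = y \<otimes> z" "x \<in> carrier G" "y \<in> carrier G" "z \<in> carrier G"
  shows "x [^] k \<otimes> y = y \<otimes> z [^] k"
proof (induction k rule: int_iff_induct)
  case 1 show ?case using assms by simp
next
  case (2 k)
  have "x [^] (k + 1) \<otimes> y = x [^] k \<otimes> y \<otimes> z"
    using assms by (simp add: int_pow_mult m_assoc)
  moreover have "y \<otimes> z [^] (k + 1) = y \<otimes> z [^] k \<otimes> z"
    using assms by (simp add: int_pow_mult m_assoc)
  ultimately show ?case using assms by simp
qed

end

section \<open>Truncated exponents\<close>

text \<open>The expansion of \<open>(1 + 2 * h) ^ k\<close> up to multiples of \<open>(2 * h)^3\<close>, which unlike the power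
  itself makes sense for negative \<open>k\<close>.\<close>

definition conj_exp :: "int \<Rightarrow> int \<Rightarrow> int" where
  "conj_exp h k = 1 + 2 * h * k + 4 * h^2 * phi k"

text \<open>The expansion of \<open>\<alpha> + \<alpha>^2 + \<dots> + \<alpha>^x\<close> for \<open>\<alpha> = 1 + 2 * h\<close>, up to multiples of
  \<open>(2 * h)^3\<close>.\<close>

definition sum_exp :: "int \<Rightarrow> int \<Rightarrow> int" where
  "sum_exp h x = x + 2 * h * phi (x + 1) + 4 * h^2 * varphi (x + 1)"

text \<open>The exponent of the central element \<open>A^(2h\<^sup>2)\<close> in the product formula, that is, \<open>xi2\<close> without its
  constant factor.\<close>

definition correction :: "int \<Rightarrow> int \<Rightarrow> int \<Rightarrow> int \<Rightarrow> int" where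
  "correction j k a b =
    phi j * phi a * (- 2 * j + 2 * a - 2 * b + 5)
     - 2 * phi j * a * (j + k + b - 1)
     - j * phi a * (4 * k - 2 * a + 1)
     + 2 * phi k * (a - b)
     - k * a * (j - 2)
     - 2 * j * (a * b + varphi (a + 1))
     + (3 * a + 1) * a * varphi j"

text \<open>The recursion in \<open>a\<close> imposed by multiplying \<open>B^j A^a\<close> by \<open>A\<close>: it collects the terms of lowest
  order in \<open>h\<close> from that product, the last two being carries from the exponents of \<open>A\<close> and \<open>B\<close>.\<close>

lemma correction_step:
  "correction j 0 (a + 1) 0 = correction j 0 a 0 + j * a * (j * a) - j * a - 2 * varphi (j + 1)
    + 2 * j * (j * a) + j * a * (j * j - j) - j * (j * a) + 2 * phi (j + 1) * phi a
    - phi j * a * (2 * j - 1)"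
proof -
  \<comment> \<open>12 clears the denominators of \<open>phi j * phi a\<close>, \<open>varphi j\<close> and \<open>varphi (a + 1)\<close>.\<close>
  have "12 * correction j 0 (a + 1) 0 = 12 * (correction j 0 a 0 + j * a * (j * a) - j * a
    - 2 * varphi (j + 1) + 2 * j * (j * a) + j * a * (j * j - j) - j * (j * a)
    + 2 * phi (j + 1) * phi a - phi j * a * (2 * j - 1))"
    using phi_double[of j] phi_Suc[of j] phi_double[of a] phi_Suc[of a] varphi_six[of j]
      varphi_Suc[of j] varphi_six[of "a + 1"] varphi_six[of "a + 1 + 1"]
    unfolding correction_def phi_zero by algebra
  then show ?thesis by simp
qed

text \<open>The effect of \<open>b\<close> and \<open>k\<close>, to lowest order in \<open>h\<close>: commuting \<open>C^k\<close> past \<open>A^a\<close> and \<open>B^b\<close>,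
  commuting the \<open>C\<close>-part of \<open>B^j A^a\<close> past \<open>B^b\<close>, and the carries from the exponents of \<open>A\<close> and
  \<open>B\<close>.\<close>

lemma correction_split:
  "correction j k a b = correction j 0 a 0 + (k * k + k) * a + (k - k * k) * b
    - (j * a * (j * a) + j * a) * b + j * k * a * (1 - 2 * a)
    - (2 * phi j * k * a - 2 * j * a * k * b + 2 * b * (j * k * a - phi (j + 1) * phi a))"
proof -
  have "4 * correction j k a b = 4 * (correction j 0 a 0 + (k * k + k) * a + (k - k * k) * b
    - (j * a * (j * a) + j * a) * b + j * k * a * (1 - 2 * a)
    - (2 * phi j * k * a - 2 * j * a * k * b + 2 * b * (j * k * a - phi (j + 1) * phi a)))"
    using phi_double[of j] phi_double[of a] phi_double[of k] phi_Suc[of j]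
    unfolding correction_def phi_zero by algebra
  then show ?thesis by simp
qed

section \<open>Collection of powers before centrality is known\<close>

text \<open>The three numerical conditions abstract from \<open>h = s * l\<close> and \<open>N = 4 * s^3\<close> with \<open>s\<close> a power
  of 2 and \<open>l\<close> odd. Coprimality to 3 lets congruences of exponents be checked after multiplication by 3,
  which clears the denominator of \<open>varphi\<close>; the last condition covers \<open>s = 1\<close>, where \<open>N = 4\<close>.\<close>

locale macdonald_pair = group G for G (structure) +
  fixes A B C :: 'a and h N :: int
  assumes A_closed [simp]: "A \<in> carrier G"
    and B_closed [simp]: "B \<in> carrier G"
    and C_closed [simp]: "C \<in> carrier G"
    and A_C: "A \<otimes> C = C \<otimes> A [^] (1 + 2 * h)"
    and C_B: "C \<otimes> B = B [^] (1 + 2 * h) \<otimes> C"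
    and A_B: "A \<otimes> B = B \<otimes> A \<otimes> C"
    and A_order: "A [^] N = \<one>"
    and B_order: "B [^] N = \<one>"
    and N_dvd: "N dvd 4 * h^3"
    and N_coprime: "coprime N 3"
    and N_odd: "odd h \<Longrightarrow> N dvd 4"
begin

text \<open>Each statement about \<open>A\<close> thereby yields one about \<open>B\<close>, with the exponents of \<open>C\<close> negated.\<close>

lemma swap: "macdonald_pair G B A (inv C) h N"
proof unfold_locales
  show "B \<otimes> inv C = inv C \<otimes> B [^] (1 + 2 * h)"
    by (metis A_closed B_closed C_B C_closed int_pow_closed inv_closed inv_solve_left
        inv_solve_right m_assoc m_closed)
  show "inv C \<otimes> A = A [^] (1 + 2 * h) \<otimes> inv C"
    by (metis A_closed A_C C_closed int_pow_closed inv_closed inv_solve_left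
        inv_solve_right m_assoc m_closed)
  show "B \<otimes> A = A \<otimes> B \<otimes> inv C"
    by (metis A_B A_closed B_closed C_closed inv_solve_right m_closed)
qed (simp_all add: A_order B_order N_dvd N_coprime N_odd)

lemma A_pow_one:
  assumes "N dvd 3 * x"
  shows "A [^] x = \<one>"
proof -
  have "N dvd x" using assms N_coprime coprime_dvd_mult_right_iff by blast
  then obtain v where "x = N * v" by (rule dvdE)
  then show ?thesis using A_order by (simp flip: int_pow_pow)
qed

text \<open>An explicit cofactor \<open>w\<close> reduces an equality of powers to a polynomial identity over the
  integers. The cofactors below come from expanding the exponents and dividing three
  times their difference by \<open>4 * h^3\<close>.\<close>

lemma A_cong:
  assumes "3 * (x - y) = 4 * h^3 * w"
  shows "A [^] x = A [^] y"
proof -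
  have "A [^] (x - y) = \<one>"
    by (rule A_pow_one) (unfold assms, use N_dvd in \<open>rule dvd_mult2\<close>)
  then show ?thesis by (metis A_closed diff_add_cancel int_pow_closed int_pow_mult l_one)
qed

lemma B_cong: "3 * (x - y) = 4 * h^3 * w \<Longrightarrow> B [^] x = B [^] y"
proof -
  interpret swap: macdonald_pair G B A "inv C" h N by (rule swap)
  show "3 * (x - y) = 4 * h^3 * w \<Longrightarrow> B [^] x = B [^] y" by (rule swap.A_cong)
qed

lemma A_pow_C_pow: "A [^] y \<otimes> C [^] k = C [^] k \<otimes> A [^] (y * conj_exp h k)"
proof (induction k rule: int_iff_induct)
  case 1 show ?case by (simp add: conj_exp_def phi_def)
next
  case (2 k)
  have step: "A [^] z \<otimes> C = C \<otimes> A [^] ((1 + 2 * h) * z)" for z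
    using int_pow_intertwine[OF A_C, of z] by (simp add: int_pow_pow)
  have "A [^] (y * conj_exp h (k + 1)) = A [^] ((1 + 2 * h) * (y * conj_exp h k))"
    by (rule A_cong[where w = "- 6 * y * phi k"])
      (use phi_Suc[of k] in \<open>unfold conj_exp_def, algebra\<close>)
  then have "C [^] (k + 1) \<otimes> A [^] (y * conj_exp h (k + 1))
      = C [^] k \<otimes> A [^] (y * conj_exp h k) \<otimes> C"
    by (simp add: int_pow_mult m_assoc step)
  moreover have "A [^] y \<otimes> C [^] (k + 1) = A [^] y \<otimes> C [^] k \<otimes> C"
    by (simp add: int_pow_mult m_assoc)
  ultimately show ?case by simp
qed

lemma C_pow_A_pow: "C [^] k \<otimes> A [^] y = A [^] (y * conj_exp h (- k)) \<otimes> C [^] k"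
proof -
  have "A [^] y \<otimes> C [^] (-k) \<otimes> C [^] k = C [^] (-k) \<otimes> A [^] (y * conj_exp h (- k)) \<otimes> C [^] k"
    by (simp add: A_pow_C_pow)
  then have "C [^] k \<otimes> A [^] y = C [^] k \<otimes> (C [^] (-k) \<otimes> (A [^] (y * conj_exp h (- k)) \<otimes> C [^] k))"
    by (simp add: m_assoc int_pow_merge)
  then show ?thesis by (simp add: int_pow_merge)
qed

lemma C_pow_B_pow: "C [^] k \<otimes> B [^] y = B [^] (y * conj_exp h k) \<otimes> C [^] k"
proof -
  interpret swap: macdonald_pair G B A "inv C" h N by (rule swap)
  show ?thesis
    using swap.C_pow_A_pow[of "- k" y] by (simp add: int_pow_neg int_pow_inv)
qed

text \<open>Conjugation by \<open>B\<close> sends \<open>A\<close> to \<open>A C\<close>, and moving all factors \<open>C\<close> of \<open>(A C)^x\<close> to the front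
  turns the factors \<open>A\<close> into \<open>A^(\<alpha>^x), \<dots>, A^\<alpha>\<close>.\<close>

lemma A_pow_B: "A [^] x \<otimes> B = B \<otimes> C [^] x \<otimes> A [^] sum_exp h x"
proof (induction x rule: int_iff_induct)
  case 1 show ?case by (simp add: sum_exp_def phi_def varphi_def)
next
  case (2 x)
  have "A \<otimes> C [^] (x + 1) = C [^] (x + 1) \<otimes> A [^] conj_exp h (x + 1)"
    using A_pow_C_pow[of 1 "x + 1"] by simp
  moreover have "sum_exp h (x + 1) = conj_exp h (x + 1) + sum_exp h x"
    using phi_Suc[of "x + 1"] varphi_Suc[of "x + 1"]
    unfolding sum_exp_def conj_exp_def by algebra
  ultimately have "B \<otimes> C [^] (x + 1) \<otimes> A [^] sum_exp h (x + 1)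
      = B \<otimes> (A \<otimes> C [^] (x + 1)) \<otimes> A [^] sum_exp h x"
    by (simp add: m_assoc int_pow_merge)
  also have "\<dots> = (A \<otimes> B) \<otimes> (C [^] x \<otimes> A [^] sum_exp h x)"
    using int_pow_mult[of C 1 x] by (simp add: A_B m_assoc add.commute)
  also have "\<dots> = A \<otimes> (B \<otimes> C [^] x \<otimes> A [^] sum_exp h x)"
    by (simp add: m_assoc)
  finally have "B \<otimes> C [^] (x + 1) \<otimes> A [^] sum_exp h (x + 1)
      = A \<otimes> (B \<otimes> C [^] x \<otimes> A [^] sum_exp h x)" .
  moreover have "A [^] (x + 1) \<otimes> B = A \<otimes> (A [^] x \<otimes> B)"
    by (metis A_closed B_closed add.commute int_pow_1 int_pow_closed int_pow_mult m_assoc)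
  ultimately show ?case by simp
qed

lemma B_pow_A: "B [^] x \<otimes> A = A \<otimes> C [^] (- x) \<otimes> B [^] sum_exp h x"
proof -
  interpret swap: macdonald_pair G B A "inv C" h N by (rule swap)
  show ?thesis
    using swap.A_pow_B[of x] by (simp add: int_pow_neg int_pow_inv)
qed

lemma B_pow_C_pow: "B [^] y \<otimes> C [^] k = C [^] k \<otimes> B [^] (y * conj_exp h (- k))"
proof -
  interpret swap: macdonald_pair G B A "inv C" h N by (rule swap)
  show ?thesis
    using swap.A_pow_C_pow[of y "- k"] by (simp add: int_pow_neg int_pow_inv)
qed

text \<open>For exponents divisible by \<open>2 * h\<close> the conjugate by \<open>B\<close> is linear in the exponent.\<close>

lemma A_pow_B_even: "A [^] (2 * h * v) \<otimes> B = B \<otimes> C [^] (2 * h * v) \<otimes> A [^] (2 * h * v + 2 * h^2 * v)"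
proof -
  have "A [^] sum_exp h (2 * h * v) = A [^] (2 * h * v + 2 * h^2 * v)"
    by (rule A_cong[where w = "3 * v^2 + v * (4 * h^2 * v^2 - 1)"])
      (use phi_Suc[of "2 * h * v"] phi_double[of "2 * h * v"] varphi_six[of "2 * h * v + 1"] in
        \<open>unfold sum_exp_def, algebra\<close>)
  then show ?thesis by (simp add: A_pow_B)
qed

text \<open>Commuting \<open>A^N = 1\<close> with \<open>B\<close> leaves \<open>C^N\<close> behind.\<close>

lemma C_order: "C [^] N = \<one>"
proof -
  have "3 * sum_exp h N = N * (3 + 3 * h * (N + 1) + 2 * h^2 * (N + 1) * (N - 1))"
    using phi_double[of "N + 1"] varphi_six[of "N + 1"] unfolding sum_exp_def by algebra
  then have "A [^] sum_exp h N = \<one>" by (intro A_pow_one) simp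
  then have "B \<otimes> C [^] N = B" using A_pow_B[of N] A_order by simp
  then show ?thesis by simp
qed

lemma C_cong:
  assumes "3 * (x - y) = 4 * h^3 * w"
  shows "C [^] x = C [^] y"
proof -
  have "N dvd 3 * (x - y)" unfolding assms using N_dvd by (rule dvd_mult2)
  then have "N dvd x - y" using N_coprime coprime_dvd_mult_right_iff by blast
  then obtain v where v: "x - y = N * v" by (rule dvdE)
  have "C [^] (x - y) = \<one>" unfolding v using C_order by (simp flip: int_pow_pow)
  then show ?thesis by (metis C_closed diff_add_cancel int_pow_closed int_pow_mult l_one)
qed

lemma A_C_commute_even: "A [^] (2 * h * v) \<otimes> C [^] (2 * h * u) = C [^] (2 * h * u) \<otimes> A [^] (2 * h * v)"
proof -
  have "A [^] (2 * h * v * conj_exp h (2 * h * u)) = A [^] (2 * h * v)"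
    by (rule A_cong[where w = "6 * v * u * (1 + h * (2 * h * u - 1))"])
      (use phi_double[of "2 * h * u"] in \<open>unfold conj_exp_def, algebra\<close>)
  then show ?thesis by (simp add: A_pow_C_pow)
qed

lemma A_square_C_commute: "A [^] (2 * h^2 * v) \<otimes> C [^] (k::int) = C [^] k \<otimes> A [^] (2 * h^2 * v)"
proof -
  have "A [^] (2 * h^2 * v * conj_exp h k) = A [^] (2 * h^2 * v)"
    by (rule A_cong[where w = "3 * (k * v + 2 * h * v * phi k)"])
      (unfold conj_exp_def, algebra)
  then show ?thesis by (simp add: A_pow_C_pow)
qed

lemma C_square_A_commute: "A [^] (y::int) \<otimes> C [^] (2 * h^2 * u) = C [^] (2 * h^2 * u) \<otimes> A [^] y"
proof -
  have "A [^] (y * conj_exp h (2 * h^2 * u)) = A [^] y"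
    by (rule A_cong[where w = "3 * y * u * (1 + h * (2 * h^2 * u - 1))"])
      (use phi_double[of "2 * h^2 * u"] in \<open>unfold conj_exp_def, algebra\<close>)
  then show ?thesis by (simp add: A_pow_C_pow)
qed

lemma B_C_commute_even: "B [^] (2 * h * v) \<otimes> C [^] (2 * h * u) = C [^] (2 * h * u) \<otimes> B [^] (2 * h * v)"
proof -
  interpret swap: macdonald_pair G B A "inv C" h N by (rule swap)
  show ?thesis
    using swap.A_C_commute_even[of v "- u"] by (simp add: int_pow_neg int_pow_inv)
qed

lemma C_square_B_commute: "B [^] (y::int) \<otimes> C [^] (2 * h^2 * u) = C [^] (2 * h^2 * u) \<otimes> B [^] y"
proof -
  interpret swap: macdonald_pair G B A "inv C" h N by (rule swap)
  show ?thesis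
    using swap.C_square_A_commute[of y "- u"] by (simp add: int_pow_neg int_pow_inv)
qed

section \<open>The central subgroup\<close>

text \<open>This is \<open>A B = B A C\<close> conjugated by \<open>C\<close>, where \<open>1 - 2h + 4h\<^sup>2\<close> is the truncated inverse of
  \<open>1 + 2h\<close>.\<close>

lemma commutator_conj_C:
  "A [^] (1 + 2 * h) \<otimes> B [^] (1 - 2 * h + 4 * h^2)
    = B [^] (1 - 2 * h + 4 * h^2) \<otimes> A [^] (1 + 2 * h) \<otimes> C"
proof -
  let ?A = "A [^] (1 + 2 * h)" and ?B = "B [^] (1 - 2 * h + 4 * h^2)"
  have B: "B \<otimes> C = C \<otimes> ?B"
    using B_pow_C_pow[of 1 1] by (simp add: conj_exp_def phi_def)
  have "C \<otimes> (?A \<otimes> ?B) = C \<otimes> ?A \<otimes> ?B" by (simp add: m_assoc)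
  also have "\<dots> = A \<otimes> (C \<otimes> ?B)" by (simp add: A_C[symmetric] m_assoc)
  also have "\<dots> = A \<otimes> B \<otimes> C" by (simp add: B[symmetric] m_assoc)
  also have "\<dots> = B \<otimes> (A \<otimes> C) \<otimes> C" by (simp add: A_B m_assoc)
  also have "\<dots> = (B \<otimes> C) \<otimes> ?A \<otimes> C" by (simp add: A_C m_assoc)
  also have "\<dots> = C \<otimes> (?B \<otimes> ?A \<otimes> C)" by (simp add: B m_assoc)
  finally show ?thesis by simp
qed

text \<open>Both sides of \<open>commutator_conj_C\<close> are rewritten, using \<open>A B = B A C\<close> once more, into the shape
  \<open>B A \<dots> C\<close>. What remains in the middle links \<open>A^(2h\<^sup>2)\<close>, \<open>B^(2h\<^sup>2)\<close> and a power of
  \<open>C\<close>, up to commuting \<open>A^(2h)\<close> with \<open>B^(2h)\<close>.\<close>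

lemma key_relation:
  "A [^] (2 * h - 2 * h^2) \<otimes> B [^] (- 2 * h) \<otimes> C [^] (2 * h)
    = C [^] (2 * h - 4 * h^2) \<otimes> B [^] (- 2 * h + 2 * h^2) \<otimes> A [^] (2 * h)"
proof -
  define n where "n = 2 * h - 4 * h^2"
  have "B [^] (- n * conj_exp h 1) = B [^] (- 2 * h)"
    by (rule B_cong[where w = 6]) (unfold n_def conj_exp_def phi_def, simp, algebra)
  then have C_B_n: "C \<otimes> B [^] (- n) = B [^] (- 2 * h) \<otimes> C"
    using C_pow_B_pow[of 1 "- n"] by simp
  have "sum_exp h (- n) = - n + 2 * h * phi (1 - n) + 4 * h^2 * varphi (1 - n)"
    by (simp add: sum_exp_def)
  then have "B [^] sum_exp h (- n) = B [^] (- 2 * h + 2 * h^2)"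
    by (intro B_cong[where w = "3 * (4 * h^2 - 4 * h + 2) + (1 - 2 * h) * (1 - (2 * h - 4 * h^2)^2)"])
      (use phi_double[of "1 - n"] varphi_six[of "1 - n"] n_def in algebra)
  then have B_n_A: "B [^] (- n) \<otimes> A = A \<otimes> C [^] n \<otimes> B [^] (- 2 * h + 2 * h^2)"
    using B_pow_A[of "- n"] by simp
  have C_A: "C [^] (2 * h) \<otimes> A [^] (1 + 2 * h + 2 * h^2) = A [^] (1 + 2 * h - 2 * h^2) \<otimes> C [^] (2 * h)"
  proof -
    have "A [^] ((1 + 2 * h + 2 * h^2) * conj_exp h (- (2 * h))) = A [^] (1 + 2 * h - 2 * h^2)"
      by (rule A_cong[where w = "3 * (- 2 - 2 * h + (2 * h + 1) * (1 + 2 * h + 2 * h^2))"])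
        (use phi_double[of "- (2 * h)"] in \<open>unfold conj_exp_def, algebra\<close>)
    then show ?thesis by (simp add: C_pow_A_pow)
  qed
  have C_B_h: "C [^] (2 * h) \<otimes> B [^] (- 2 * h) = B [^] (- 2 * h) \<otimes> C [^] (2 * h)"
    using B_C_commute_even[of "-1" 1] by simp
  have A_B_h: "A [^] (2 * h) \<otimes> B = B \<otimes> C [^] (2 * h) \<otimes> A [^] (2 * h + 2 * h^2)"
    using A_pow_B_even[of 1] by simp
  have pA: "A [^] (1 + z) = A [^] z \<otimes> A" "A [^] (1 + z) = A \<otimes> A [^] z" for z :: int
    using int_pow_mult[of A 1 z] int_pow_mult[of A z 1] by (simp_all add: add.commute)
  have "A [^] (1 + 2 * h) \<otimes> B [^] (1 - n) = A [^] (2 * h) \<otimes> (A \<otimes> B) \<otimes> B [^] (- n)"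
    using int_pow_mult[of B 1 "- n"] by (simp add: pA(1) m_assoc)
  also have "\<dots> = (A [^] (2 * h) \<otimes> B) \<otimes> A \<otimes> (C \<otimes> B [^] (- n))"
    by (simp add: A_B m_assoc)
  also have "\<dots> = B \<otimes> C [^] (2 * h) \<otimes> (A [^] (2 * h + 2 * h^2) \<otimes> A) \<otimes> B [^] (- 2 * h) \<otimes> C"
    unfolding A_B_h C_B_n by (simp add: m_assoc)
  also have "A [^] (2 * h + 2 * h^2) \<otimes> A = A [^] (1 + 2 * h + 2 * h^2)"
    by (simp add: pA(1)[symmetric] add.assoc)
  also have "B \<otimes> C [^] (2 * h) \<otimes> A [^] (1 + 2 * h + 2 * h^2) \<otimes> B [^] (- 2 * h) \<otimes> C
      = B \<otimes> (C [^] (2 * h) \<otimes> A [^] (1 + 2 * h + 2 * h^2)) \<otimes> B [^] (- 2 * h) \<otimes> C"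
    by (simp add: m_assoc)
  also have "\<dots> = B \<otimes> A [^] (1 + 2 * h - 2 * h^2) \<otimes> (C [^] (2 * h) \<otimes> B [^] (- 2 * h)) \<otimes> C"
    unfolding C_A by (simp add: m_assoc)
  also have "\<dots> = B \<otimes> (A \<otimes> (A [^] (2 * h - 2 * h^2) \<otimes> B [^] (- 2 * h) \<otimes> C [^] (2 * h))) \<otimes> C"
    unfolding C_B_h using pA(2)[of "2 * h - 2 * h^2"] by (simp add: m_assoc add_diff_eq)
  finally have lhs: "A [^] (1 + 2 * h) \<otimes> B [^] (1 - n)
      = B \<otimes> (A \<otimes> (A [^] (2 * h - 2 * h^2) \<otimes> B [^] (- 2 * h) \<otimes> C [^] (2 * h))) \<otimes> C" .
  have "B [^] (1 - n) \<otimes> A [^] (1 + 2 * h) \<otimes> C = B \<otimes> (B [^] (- n) \<otimes> A) \<otimes> A [^] (2 * h) \<otimes> C"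
    using int_pow_mult[of B 1 "- n"] by (simp add: pA(2) m_assoc)
  also have "\<dots> = B \<otimes> (A \<otimes> (C [^] n \<otimes> B [^] (- 2 * h + 2 * h^2) \<otimes> A [^] (2 * h))) \<otimes> C"
    unfolding B_n_A by (simp add: m_assoc)
  finally have rhs: "B [^] (1 - n) \<otimes> A [^] (1 + 2 * h) \<otimes> C
      = B \<otimes> (A \<otimes> (C [^] n \<otimes> B [^] (- 2 * h + 2 * h^2) \<otimes> A [^] (2 * h))) \<otimes> C" .
  have "1 - n = 1 - 2 * h + 4 * h^2" by (simp add: n_def)
  then have "B \<otimes> (A \<otimes> (A [^] (2 * h - 2 * h^2) \<otimes> B [^] (- 2 * h) \<otimes> C [^] (2 * h))) \<otimes> C
      = B \<otimes> (A \<otimes> (C [^] n \<otimes> B [^] (- 2 * h + 2 * h^2) \<otimes> A [^] (2 * h))) \<otimes> C"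
    using commutator_conj_C lhs rhs by metis
  then show ?thesis by (simp add: n_def)
qed

text \<open>Iterating \<open>A_pow_B_even\<close>. The exponents of \<open>A\<close> satisfy the recursion
  \<open>p \<mapsto> 1 + (1 + h) * p\<close>, whose solution is \<open>j + h * phi j\<close> modulo \<open>2 * h\<close> because \<open>h^2\<close> vanishes
  there when \<open>h\<close> is even; those of \<open>C\<close> are its partial sums.\<close>

lemma A_pow_B_pow_even:
  assumes "h = 2 * g"
  shows "A [^] (2 * h * w) \<otimes> B [^] (j::int)
    = B [^] (j + 4 * h^2 * w * phi j)
      \<otimes> C [^] (2 * h * w * j + 2 * h^2 * w * (phi j + h * varphi j))
      \<otimes> A [^] (2 * h * w + 2 * h^2 * w * (j + h * phi j))"
proof (induction j rule: int_iff_induct)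
  case 1 show ?case by (simp add: phi_def varphi_def)
next
  case (2 j)
  define p q where "p = j + h * phi j" and "q = phi j + h * varphi j"
  define p' q' where "p' = j + 1 + h * phi (j + 1)" and "q' = phi (j + 1) + h * varphi (j + 1)"
  define u v where "u = w * (j + h * q)" and "v = w * (1 + h * p)"
  have pq: "q' = q + p"
    using phi_Suc[of j] varphi_Suc[of j] unfolding p_def q_def q'_def by algebra
  have p': "p' = 1 + p + h * j"
    using phi_Suc[of j] unfolding p_def p'_def by algebra
  have C_B_u: "C [^] (2 * h * u) \<otimes> B = B [^] conj_exp h (2 * h * u) \<otimes> C [^] (2 * h * u)"
    using C_pow_B_pow[of "2 * h * u" 1] by simp
  have A_exp: "A [^] (2 * h * v + 2 * h^2 * v) = A [^] (2 * h * w + 2 * h^2 * w * p')"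
    by (rule A_cong[where w = "3 * g * w * phi j"])
      (use assms p' p_def v_def in algebra)
  have B_exp: "B [^] (j + 4 * h^2 * w * phi j + conj_exp h (2 * h * u))
      = B [^] (j + 1 + 4 * h^2 * w * phi (j + 1))"
    by (rule B_cong[where w = "3 * (w * q + u * (2 * h * u - 1))"])
      (use phi_double[of "2 * h * u"] phi_Suc[of j] u_def in \<open>unfold conj_exp_def, algebra\<close>)
  have C_exp: "2 * h * u + 2 * h * v = 2 * h * w * (j + 1) + 2 * h^2 * w * q'"
    by (simp add: u_def v_def pq algebra_simps power2_eq_square)
  have "B [^] (j + 4 * h^2 * w * phi j) \<otimes> C [^] (2 * h * u) \<otimes> A [^] (2 * h * v) \<otimes> B
      = B [^] (j + 4 * h^2 * w * phi j) \<otimes> (C [^] (2 * h * u) \<otimes> B)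
        \<otimes> C [^] (2 * h * v) \<otimes> A [^] (2 * h * v + 2 * h^2 * v)"
    by (simp add: m_assoc A_pow_B_even)
  also have "\<dots> = B [^] (j + 1 + 4 * h^2 * w * phi (j + 1))
      \<otimes> C [^] (2 * h * w * (j + 1) + 2 * h^2 * w * q')
      \<otimes> A [^] (2 * h * w + 2 * h^2 * w * p')"
    unfolding C_B_u B_exp[symmetric] C_exp[symmetric] A_exp by (simp add: m_assoc int_pow_merge)
  finally have step: "B [^] (j + 1 + 4 * h^2 * w * phi (j + 1))
      \<otimes> C [^] (2 * h * w * (j + 1) + 2 * h^2 * w * q')
      \<otimes> A [^] (2 * h * w + 2 * h^2 * w * p')
    = B [^] (j + 4 * h^2 * w * phi j) \<otimes> C [^] (2 * h * w * j + 2 * h^2 * w * q)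
      \<otimes> A [^] (2 * h * w + 2 * h^2 * w * p) \<otimes> B"
    by (simp add: u_def v_def algebra_simps power2_eq_square)
  have "A [^] (2 * h * w) \<otimes> B [^] (j + 1) = A [^] (2 * h * w) \<otimes> B [^] j \<otimes> B"
    by (simp add: int_pow_mult m_assoc)
  then show ?case
    using step unfolding p_def q_def p'_def q'_def by simp
qed

text \<open>For even \<open>h\<close> the commutator of \<open>A^(2h - 2h\<^sup>2)\<close> and \<open>B^(-2h)\<close> is the central element
  \<open>C^(-4h\<^sup>2 + 2h\<^sup>3)\<close>; inserted into \<open>key_relation\<close> it leaves only powers whose exponents are
  multiples of \<open>2h\<^sup>2\<close>.\<close>

lemma B_square_even:
  assumes "h = 2 * g"
  shows "B [^] (2 * h^2) = C [^] (2 * h^3) \<otimes> A [^] (- 2 * h^2)"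
proof -
  let ?b = "B [^] (- 2 * h)" and ?c = "C [^] (2 * h - 4 * h^2)"
  have "A [^] (2 * h * (1 - h)) \<otimes> ?b = ?b \<otimes> C [^] (- 4 * h^2 + 2 * h^3) \<otimes> A [^] (2 * h * (1 - h))"
  proof -
    let ?j = "- 2 * h"
    have "B [^] (?j + 4 * h^2 * (1 - h) * phi ?j) = ?b"
      by (rule B_cong[where w = "3 * (1 - h) * (2 * h + 1)"])
        (use phi_double[of ?j] in algebra)
    moreover have "C [^] (2 * h * (1 - h) * ?j + 2 * h^2 * (1 - h) * (phi ?j + h * varphi ?j))
        = C [^] (- 4 * h^2 + 2 * h^3)"
      by (rule C_cong[where w = "3 + 3 * g * (1 - 2 * h) - h * (1 - h) * (2 * h + 1) * (h + 1)"])
        (use phi_double[of ?j] varphi_six[of ?j] assms in algebra)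
    moreover have "A [^] (2 * h * (1 - h) + 2 * h^2 * (1 - h) * (?j + h * phi ?j))
        = A [^] (2 * h * (1 - h))"
      by (rule A_cong[where w = "3 * (1 - h) * (g * (2 * h + 1) - 1)"])
        (use phi_double[of ?j] assms in algebra)
    ultimately show ?thesis using A_pow_B_pow_even[OF assms, of "1 - h" ?j] by simp
  qed
  then have "?b \<otimes> C [^] (- 4 * h^2 + 2 * h^3) \<otimes> A [^] (2 * h * (1 - h)) \<otimes> C [^] (2 * h)
      = ?c \<otimes> B [^] (- 2 * h + 2 * h^2) \<otimes> A [^] (2 * h)"
    using key_relation by (simp add: algebra_simps power2_eq_square)
  also have "?b \<otimes> C [^] (- 4 * h^2 + 2 * h^3) \<otimes> A [^] (2 * h * (1 - h)) \<otimes> C [^] (2 * h)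
      = ?b \<otimes> C [^] (2 * h^3 + (2 * h - 4 * h^2)) \<otimes> A [^] (2 * h * (1 - h))"
    using A_C_commute_even[of "1 - h" 1] by (simp add: m_assoc int_pow_merge algebra_simps)
  also have "\<dots> = ?b \<otimes> (C [^] (2 * h^3) \<otimes> ?c) \<otimes> A [^] (2 * h * (1 - h))"
    by (simp add: int_pow_mult)
  also have "C [^] (2 * h^3) \<otimes> ?c = ?c \<otimes> C [^] (2 * h^3)"
    by (simp add: int_pow_merge add.commute)
  also have "?b \<otimes> (?c \<otimes> C [^] (2 * h^3)) = (?b \<otimes> ?c) \<otimes> C [^] (2 * h^3)"
    by (simp add: m_assoc)
  also have "?b \<otimes> ?c = ?c \<otimes> ?b"
    using B_C_commute_even[of "-1" "1 - 2 * h"] by (simp add: algebra_simps power2_eq_square)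
  finally have "(?c \<otimes> ?b) \<otimes> (C [^] (2 * h^3) \<otimes> A [^] (2 * h * (1 - h)))
      = (?c \<otimes> ?b) \<otimes> (B [^] (2 * h^2) \<otimes> A [^] (2 * h))"
    by (simp add: m_assoc int_pow_merge)
  then have "C [^] (2 * h^3) \<otimes> A [^] (2 * h * (1 - h)) = B [^] (2 * h^2) \<otimes> A [^] (2 * h)"
    by simp
  also have "2 * h * (1 - h) = - 2 * h^2 + 2 * h" by (simp add: algebra_simps power2_eq_square)
  finally have "(C [^] (2 * h^3) \<otimes> A [^] (- 2 * h^2)) \<otimes> A [^] (2 * h) = B [^] (2 * h^2) \<otimes> A [^] (2 * h)"
    by (simp only: m_assoc int_pow_mult int_pow_closed A_closed C_closed)
  then show ?thesis by simp
qed

lemma A_square_B: "A [^] (2 * h^2) \<otimes> B = B \<otimes> C [^] (2 * h^2) \<otimes> A [^] (2 * h^2 + 2 * h^3)"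
  using A_pow_B_even[of h] by (simp add: power2_eq_square power3_eq_cube mult.assoc)

text \<open>Even \<open>h\<close>: by \<open>B_square_even\<close>, \<open>A^(2h\<^sup>2)\<close> is a power of \<open>B\<close> times a central element, hence
  commutes with \<open>B\<close>; then \<open>A_square_B\<close> forces \<open>C^(2h\<^sup>2) = A^(-2h\<^sup>3)\<close>, an element of order at most 2
  whose \<open>h\<close>-th power is trivial. Odd \<open>h\<close>: as \<open>A^4 = 1\<close> and \<open>2h\<^sup>2 + 2h\<^sup>3\<close> is divisible by 4,
  \<open>A_square_B\<close> says directly that the conjugate of \<open>A^(2h\<^sup>2)\<close> by \<open>B\<close> is the central element
  \<open>C^(2h\<^sup>2)\<close>.\<close>

lemma central_powers:
  shows "A [^] (2 * h^2) \<otimes> B = B \<otimes> A [^] (2 * h^2)"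
    and "C [^] (2 * h^2) = A [^] (2 * h^3)"
    and "B [^] (2 * h^2) = A [^] (- 2 * h^2)"
proof -
  have C_central: "B \<otimes> C [^] (2 * h^2) = C [^] (2 * h^2) \<otimes> B"
    using C_square_B_commute[of 1 1] by simp
  have "A [^] (2 * h^2) \<otimes> B = B \<otimes> A [^] (2 * h^2) \<and> C [^] (2 * h^2) = A [^] (2 * h^3)
      \<and> B [^] (2 * h^2) = A [^] (- 2 * h^2)"
  proof (cases "even h")
    case True
    then obtain g where g: "h = 2 * g" by (rule evenE)
    have A_inv: "A [^] (- 2 * h^2) = C [^] (- 2 * h^3) \<otimes> B [^] (2 * h^2)"
      unfolding B_square_even[OF g] by (simp add: int_pow_merge)
    have "A [^] (- 2 * h^2) \<otimes> B = B \<otimes> A [^] (- 2 * h^2)"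
    proof -
      have "B \<otimes> C [^] (- 2 * h^3) = C [^] (- 2 * h^3) \<otimes> B"
        using C_square_B_commute[of 1 "- h"] by (simp add: power2_eq_square power3_eq_cube mult.assoc)
      moreover have "B [^] (2 * h^2) \<otimes> B = B \<otimes> B [^] (2 * h^2)"
        using int_pow_merge(1)[of B "2 * h^2" 1] int_pow_merge(1)[of B 1 "2 * h^2"]
        by (simp add: add.commute)
      ultimately show ?thesis unfolding A_inv by (metis B_closed C_closed int_pow_closed m_assoc)
    qed
    then have "A [^] (2 * h^2) \<otimes> (A [^] (- 2 * h^2) \<otimes> B) \<otimes> A [^] (2 * h^2)
        = A [^] (2 * h^2) \<otimes> (B \<otimes> A [^] (- 2 * h^2)) \<otimes> A [^] (2 * h^2)" by simp
    then have comm: "A [^] (2 * h^2) \<otimes> B = B \<otimes> A [^] (2 * h^2)"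
      by (simp add: m_assoc int_pow_merge)
    then have "B \<otimes> (A [^] (2 * h^2)) = B \<otimes> (C [^] (2 * h^2) \<otimes> A [^] (2 * h^3) \<otimes> A [^] (2 * h^2))"
      using A_square_B by (simp add: m_assoc int_pow_merge add.commute)
    then have "C [^] (2 * h^2) \<otimes> A [^] (2 * h^3) = \<one>"
      by simp
    moreover have "A [^] (2 * h^3) \<otimes> A [^] (2 * h^3) = \<one>"
      using A_cong[of "4 * h^3" 0 3] by (simp add: int_pow_merge)
    ultimately have C: "C [^] (2 * h^2) = A [^] (2 * h^3)"
      by (metis A_closed C_closed int_pow_closed right_cancel)
    have "C [^] (2 * h^3) = (C [^] (2 * h^2)) [^] h"
      by (simp add: int_pow_pow power2_eq_square power3_eq_cube mult.assoc)
    also have "\<dots> = A [^] (2 * h^3 * h)" unfolding C by (simp add: int_pow_pow)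
    also have "\<dots> = A [^] (0::int)" by (rule A_cong[where w = "3 * g"]) (use g in algebra)
    finally have "C [^] (2 * h^3) = \<one>" by simp
    then show ?thesis using comm C B_square_even[OF g] by simp
  next
    case False
    then have "N dvd 4" by (rule N_odd)
    interpret swap: macdonald_pair G B A "inv C" h N by (rule swap)
    from False obtain g where g: "h = 2 * g + 1" by (rule oddE)
    have A4: "A [^] x = A [^] y" if "x - y = 4 * w" for x y w :: int
    proof -
      have "A [^] (x - y) = \<one>" by (rule A_pow_one) (unfold that, rule dvd_mult, rule dvd_mult2, fact)
      then show ?thesis by (metis A_closed diff_add_cancel int_pow_closed int_pow_mult l_one)
    qed
    have B4: "B [^] x = B [^] y" if "x - y = 4 * w" for x y w :: int
    proof -
      have "B [^] (x - y) = \<one>" by (rule swap.A_pow_one) (unfold that, rule dvd_mult, rule dvd_mult2, fact)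
      then show ?thesis by (metis B_closed diff_add_cancel int_pow_closed int_pow_mult l_one)
    qed
    have A0: "A [^] (2 * h^2 + 2 * h^3) = \<one>"
      using A4[of "2 * h^2 + 2 * h^3" 0 "h^2 * (g + 1)"] g by (simp add: power2_eq_square power3_eq_cube algebra_simps)
    have B0: "B [^] (2 * h^2 + 2 * h^3) = \<one>"
      using B4[of "2 * h^2 + 2 * h^3" 0 "h^2 * (g + 1)"] g by (simp add: power2_eq_square power3_eq_cube algebra_simps)
    have AC: "A [^] (2 * h^2) = C [^] (2 * h^2)"
      using A_square_B C_central A0 by simp
    have "B [^] (2 * h^2) \<otimes> A = A \<otimes> C [^] (- 2 * h^2)"
      using swap.A_square_B B0 by (simp add: int_pow_neg int_pow_inv)
    also have "\<dots> = C [^] (- 2 * h^2) \<otimes> A"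
      using C_square_A_commute[of 1 "-1"] by simp
    finally have BC: "B [^] (2 * h^2) = C [^] (- 2 * h^2)" by simp
    have "A [^] (2 * h^2) = A [^] (2 * h^3)"
      by (rule A4[of _ _ "- (h^2 * g)"]) (use g in algebra)
    moreover have "C [^] (- 2 * h^2) = A [^] (- 2 * h^2)"
      using AC by (simp add: int_pow_neg)
    ultimately show ?thesis using AC BC C_central by simp
  qed
  then show "A [^] (2 * h^2) \<otimes> B = B \<otimes> A [^] (2 * h^2)"
    and "C [^] (2 * h^2) = A [^] (2 * h^3)"
    and "B [^] (2 * h^2) = A [^] (- 2 * h^2)" by auto
qed

section \<open>Words with a central factor\<close>

definition zeta :: "int \<Rightarrow> 'a" where
  "zeta w = A [^] (2 * h^2 * w)"

lemma zeta_closed [simp]: "zeta w \<in> carrier G"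
  by (simp add: zeta_def)

lemma zeta_zero [simp]: "zeta 0 = \<one>"
  by (simp add: zeta_def)

lemma zeta_A: "zeta w \<otimes> A [^] (y::int) = A [^] y \<otimes> zeta w"
  by (simp add: zeta_def int_pow_merge add.commute)

lemma zeta_B: "zeta w \<otimes> B [^] (y::int) = B [^] y \<otimes> zeta w"
proof -
  have "zeta w \<otimes> B = B \<otimes> zeta w"
    using int_pow_intertwine[OF central_powers(1), of w] by (simp add: zeta_def int_pow_pow)
  from int_pow_intertwine[OF this[symmetric], of y] show ?thesis by simp
qed

lemma zeta_C: "zeta w \<otimes> C [^] (y::int) = C [^] y \<otimes> zeta w"
  by (simp add: zeta_def A_square_C_commute)

lemma zeta_add: "zeta v \<otimes> zeta w = zeta (v + w)"
  by (simp add: zeta_def int_pow_merge distrib_left)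

lemmas zeta_moves = zeta_A zeta_B zeta_C zeta_add
  zeta_A[THEN commute_tail] zeta_B[THEN commute_tail] zeta_C[THEN commute_tail]

lemma zeta_cong:
  assumes "3 * (v - w) = 2 * h * u"
  shows "zeta v = zeta w"
  unfolding zeta_def by (rule A_cong[where w = u]) (use assms in algebra)

lemma A_shift: "A [^] (x + 2 * h^2 * w) = A [^] x \<otimes> zeta w"
  by (simp add: zeta_def int_pow_mult)

lemma B_shift: "B [^] (y + 2 * h^2 * w) = B [^] y \<otimes> zeta (- w)"
proof -
  have "B [^] (2 * h^2 * w) = (B [^] (2 * h^2)) [^] w" by (simp add: int_pow_pow)
  then show ?thesis by (simp add: central_powers(3) zeta_def int_pow_mult int_pow_pow)
qed

lemma C_shift: "C [^] (z + 2 * h^2 * w) = C [^] z \<otimes> zeta (h * w)"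
proof -
  have "C [^] (2 * h^2 * w) = (C [^] (2 * h^2)) [^] w" by (simp add: int_pow_pow)
  also have "\<dots> = A [^] (2 * h^3 * w)" by (simp add: central_powers(2) int_pow_pow)
  also have "2 * h^3 * w = 2 * h^2 * (h * w)" by algebra
  finally show ?thesis by (simp add: zeta_def int_pow_mult)
qed

definition nf :: "int \<Rightarrow> int \<Rightarrow> int \<Rightarrow> int \<Rightarrow> 'a" where
  "nf x y z w = A [^] x \<otimes> B [^] y \<otimes> C [^] z \<otimes> zeta w"

lemma nf_closed [simp]: "nf x y z w \<in> carrier G"
  by (simp add: nf_def)

text \<open>The carries: \<open>p\<close>, \<open>q\<close>, \<open>r\<close> are the multiples of \<open>2h\<^sup>2\<close> by which the first three exponents
  differ, and they enter the exponent of the central factor with the weights 1, \<open>-1\<close>, \<open>h\<close> given by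
  \<open>central_powers\<close>.\<close>

lemma nf_cong:
  assumes "x' = x + 2 * h^2 * p" "y' = y + 2 * h^2 * q" "z' = z + 2 * h^2 * r"
    and "3 * (w' + p - q + h * r - w) = 2 * h * u"
  shows "nf x' y' z' w' = nf x y z w"
proof -
  have "nf x' y' z' w' = A [^] x \<otimes> B [^] y \<otimes> C [^] z \<otimes> zeta (p - q + h * r + w')"
    by (simp add: nf_def assms(1-3) A_shift B_shift C_shift m_assoc zeta_moves add_ac)
  also have "zeta (p - q + h * r + w') = zeta w"
    by (rule zeta_cong[where u = u]) (use assms(4) in algebra)
  finally show ?thesis by (simp add: nf_def)
qed

lemma C_A_collect: "C [^] k \<otimes> A [^] y = A [^] (y - 2 * h * k * y) \<otimes> C [^] k \<otimes> zeta ((k * k + k) * y)"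
proof -
  have "y * conj_exp h (- k) = (y - 2 * h * k * y) + 2 * h^2 * ((k * k + k) * y)"
    using phi_double[of "- k"] unfolding conj_exp_def by algebra
  then show ?thesis by (simp add: C_pow_A_pow A_shift m_assoc zeta_moves)
qed

lemma C_B_collect: "C [^] k \<otimes> B [^] y = B [^] (y + 2 * h * k * y) \<otimes> C [^] k \<otimes> zeta ((k - k * k) * y)"
proof -
  have exp: "y * conj_exp h k = (y + 2 * h * k * y) + 2 * h^2 * (- ((k - k * k) * y))"
    using phi_double[of k] unfolding conj_exp_def by algebra
  show ?thesis unfolding C_pow_B_pow exp B_shift by (simp add: m_assoc zeta_moves)
qed

text \<open>The exponent of \<open>B\<close> is \<open>1 + \<alpha>^(-1) + \<dots> + \<alpha>^(1 - j)\<close>, expanded to second order.\<close>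

lemma B_A_collect:
  "B [^] j \<otimes> A = A \<otimes> B [^] (j - 2 * h * phi j) \<otimes> C [^] (- j) \<otimes> zeta (- 2 * varphi (j + 1))"
proof -
  let ?p = "phi j + j" and ?v = "varphi (j + 1)"
  have "B [^] (sum_exp h j * conj_exp h (- j)) = B [^] (j - 2 * h * phi j + 2 * h^2 * (2 * ?v))"
    by (rule B_cong[where w = "3 * (2 * (?p^2 - j * ?v) + 4 * h * ?v * ?p)"])
      (use phi_double[of j] phi_Suc[of j] phi_minus[of j] in
        \<open>unfold conj_exp_def sum_exp_def, algebra\<close>)
  also have "\<dots> = B [^] (j - 2 * h * phi j) \<otimes> zeta (- 2 * ?v)"
    unfolding B_shift by simp
  finally show ?thesis
    by (simp add: B_pow_A C_pow_B_pow m_assoc zeta_moves)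
qed

text \<open>Moving \<open>A\<close> past \<open>C^z\<close> splits off a power of \<open>A\<close> whose exponent is divisible by \<open>2 * h\<close>. That
  power passes \<open>B^j\<close> at the cost of a power of \<open>C\<close> and of central elements alone, so the collection
  of a single \<open>A\<close> terminates.\<close>

lemma B_A_even_collect:
  "B [^] (j::int) \<otimes> A [^] (2 * h * x)
    = A [^] (2 * h * x) \<otimes> B [^] j \<otimes> C [^] (- 2 * h * j * x) \<otimes> zeta (2 * x * phi j - j * x)"
proof (induction j rule: int_iff_induct)
  case 1 show ?case by (simp add: phi_def)
next
  case (2 j)
  have "A [^] (2 * h * x) \<otimes> B = B \<otimes> (C [^] (2 * h * x) \<otimes> A [^] (2 * h * x)) \<otimes> zeta x"
    by (simp add: A_pow_B_even A_shift m_assoc)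
  then have AB: "A [^] (2 * h * x) \<otimes> B = B \<otimes> A [^] (2 * h * x) \<otimes> C [^] (2 * h * x) \<otimes> zeta x"
    by (simp add: A_C_commute_even m_assoc)
  have BA: "B \<otimes> A [^] (2 * h * x) = A [^] (2 * h * x) \<otimes> B \<otimes> C [^] (- (2 * h * x)) \<otimes> zeta (- x)"
    unfolding AB by (simp add: m_assoc zeta_moves int_pow_merge)
  have CB: "C [^] (- (2 * h * x)) \<otimes> B [^] j = B [^] j \<otimes> C [^] (- (2 * h * x)) \<otimes> zeta (2 * x * j)"
  proof -
    let ?k = "- (2 * h * x)"
    have "j + 2 * h * ?k * j = j + 2 * h^2 * (- (2 * x * j))" by algebra
    then have "C [^] ?k \<otimes> B [^] j
        = B [^] j \<otimes> zeta (- (- (2 * x * j))) \<otimes> C [^] ?k \<otimes> zeta ((?k - ?k * ?k) * j)"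
      unfolding C_B_collect by (simp only: B_shift)
    also have "\<dots> = B [^] j \<otimes> C [^] ?k \<otimes> zeta (2 * x * j + (?k - ?k * ?k) * j)"
      by (simp only: m_assoc zeta_moves int_pow_closed B_closed C_closed zeta_closed m_closed minus_minus)
    also have "zeta (2 * x * j + (?k - ?k * ?k) * j) = zeta (2 * x * j)"
      by (rule zeta_cong[where u = "3 * (- x - x * (2 * h * x)) * j"]) algebra
    finally show ?thesis .
  qed
  have "B \<otimes> (A [^] (2 * h * x) \<otimes> B [^] j \<otimes> C [^] (- 2 * h * j * x) \<otimes> zeta (2 * x * phi j - j * x))
      = (B \<otimes> A [^] (2 * h * x)) \<otimes> B [^] j \<otimes> C [^] (- 2 * h * j * x) \<otimes> zeta (2 * x * phi j - j * x)"
    by (simp add: m_assoc)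
  also have "\<dots> = A [^] (2 * h * x) \<otimes> B \<otimes> (C [^] (- (2 * h * x)) \<otimes> B [^] j)
      \<otimes> C [^] (- 2 * h * j * x) \<otimes> zeta (- x + (2 * x * phi j - j * x))"
    unfolding BA by (simp add: m_assoc zeta_moves)
  also have "\<dots> = A [^] (2 * h * x) \<otimes> (B \<otimes> B [^] j) \<otimes> C [^] (- (2 * h * x) + - 2 * h * j * x)
      \<otimes> zeta (2 * x * j + (- x + (2 * x * phi j - j * x)))"
    unfolding CB by (simp add: m_assoc zeta_moves int_pow_merge)
  also have "B \<otimes> B [^] j = B [^] (j + 1)"
    using int_pow_mult[of B 1 j] by (simp add: add.commute)
  also have "- (2 * h * x) + - 2 * h * j * x = - 2 * h * (j + 1) * x" by algebra
  also have "2 * x * j + (- x + (2 * x * phi j - j * x)) = 2 * x * phi (j + 1) - (j + 1) * x"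
    using phi_Suc[of j] by algebra
  finally have rhs: "A [^] (2 * h * x) \<otimes> B [^] (j + 1) \<otimes> C [^] (- 2 * h * (j + 1) * x)
        \<otimes> zeta (2 * x * phi (j + 1) - (j + 1) * x)
      = B \<otimes> (A [^] (2 * h * x) \<otimes> B [^] j \<otimes> C [^] (- 2 * h * j * x) \<otimes> zeta (2 * x * phi j - j * x))" ..
  have "B [^] (j + 1) \<otimes> A [^] (2 * h * x) = B \<otimes> (B [^] j \<otimes> A [^] (2 * h * x))"
    using int_pow_mult[of B 1 j] by (simp add: m_assoc add.commute)
  then show ?case unfolding rhs by simp
qed

lemma nf_mult_A:
  defines "g y \<equiv> y - 2 * h * phi y"
  shows "nf x y z w \<otimes> A = nf (x + 1 - 2 * h * z) (g y) (z - y + 2 * h * g y * z)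
    (w + z * z + z - 2 * varphi (y + 1) - 2 * y * z - z * (g y * g y - g y) + g y * z)"
proof -
  let ?g = "g y"
  have "nf x y z w \<otimes> A = A [^] x \<otimes> B [^] y \<otimes> (C [^] z \<otimes> A [^] (1::int)) \<otimes> zeta w"
    using zeta_A[of w 1] by (simp add: nf_def m_assoc)
  also have "C [^] z \<otimes> A [^] (1::int) = A \<otimes> A [^] (2 * h * - z) \<otimes> C [^] z \<otimes> zeta (z * z + z)"
    using C_A_collect[of z 1] int_pow_mult[of A 1 "2 * h * - z"] by simp
  also have "A [^] x \<otimes> B [^] y \<otimes> (A \<otimes> A [^] (2 * h * - z) \<otimes> C [^] z \<otimes> zeta (z * z + z)) \<otimes> zeta w
      = A [^] x \<otimes> (B [^] y \<otimes> A) \<otimes> A [^] (2 * h * - z) \<otimes> C [^] z \<otimes> zeta (z * z + z + w)"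
    by (simp add: m_assoc zeta_moves)
  also have "\<dots> = A [^] x \<otimes> A \<otimes> B [^] ?g \<otimes> (C [^] (- y) \<otimes> A [^] (2 * h * - z)) \<otimes> C [^] z
      \<otimes> zeta (- 2 * varphi (y + 1) + (z * z + z + w))"
    unfolding B_A_collect g_def by (simp add: m_assoc zeta_moves del: mult_minus_left mult_minus_right)
  also have "C [^] (- y) \<otimes> A [^] (2 * h * - z) = A [^] (2 * h * - z) \<otimes> C [^] (- y) \<otimes> zeta (- 2 * y * z)"
  proof -
    have "2 * h * - z - 2 * h * - y * (2 * h * - z) = 2 * h * - z + 2 * h^2 * (- 2 * y * z)"
      by algebra
    then have "C [^] (- y) \<otimes> A [^] (2 * h * - z)
        = A [^] (2 * h * - z) \<otimes> zeta (- 2 * y * z) \<otimes> C [^] (- y)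
          \<otimes> zeta ((- y * - y + - y) * (2 * h * - z))"
      unfolding C_A_collect by (simp only: A_shift)
    also have "\<dots> = A [^] (2 * h * - z) \<otimes> C [^] (- y)
        \<otimes> zeta (- 2 * y * z + (- y * - y + - y) * (2 * h * - z))"
      by (simp only: m_assoc zeta_moves int_pow_closed A_closed C_closed zeta_closed m_closed)
    also have "zeta (- 2 * y * z + (- y * - y + - y) * (2 * h * - z)) = zeta (- 2 * y * z)"
      by (rule zeta_cong[where u = "- 3 * (y * y - y) * z"]) algebra
    finally show ?thesis .
  qed
  also have "A [^] x \<otimes> A \<otimes> B [^] ?g \<otimes> (A [^] (2 * h * - z) \<otimes> C [^] (- y) \<otimes> zeta (- 2 * y * z)) \<otimes> C [^] z
      \<otimes> zeta (- 2 * varphi (y + 1) + (z * z + z + w))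
    = A [^] x \<otimes> A \<otimes> (B [^] ?g \<otimes> A [^] (2 * h * - z)) \<otimes> C [^] (- y) \<otimes> C [^] z
      \<otimes> zeta (- 2 * y * z + (- 2 * varphi (y + 1) + (z * z + z + w)))"
    by (simp add: m_assoc zeta_moves)
  also have "\<dots> = (A [^] x \<otimes> A \<otimes> A [^] (2 * h * - z)) \<otimes> B [^] ?g
      \<otimes> (C [^] (- 2 * h * ?g * - z) \<otimes> C [^] (- y) \<otimes> C [^] z)
      \<otimes> zeta (2 * - z * phi ?g - ?g * - z
          + (- 2 * y * z + (- 2 * varphi (y + 1) + (z * z + z + w))))"
    unfolding B_A_even_collect by (simp only: m_assoc zeta_moves A_closed B_closed C_closed
        int_pow_closed zeta_closed m_closed)
  also have "A [^] x \<otimes> A \<otimes> A [^] (2 * h * - z) = A [^] (x + 1 - 2 * h * z)"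
    using int_pow_mult[of A x 1] int_pow_merge(1)[of A "x + 1" "2 * h * - z"] by simp
  also have "C [^] (- 2 * h * ?g * - z) \<otimes> C [^] (- y) \<otimes> C [^] z = C [^] (z - y + 2 * h * ?g * z)"
    by (simp add: int_pow_merge algebra_simps)
  also have "2 * - z * phi ?g - ?g * - z + (- 2 * y * z + (- 2 * varphi (y + 1) + (z * z + z + w)))
      = w + z * z + z - 2 * varphi (y + 1) - 2 * y * z - z * (?g * ?g - ?g) + ?g * z"
    using phi_double[of ?g] by algebra
  finally show ?thesis by (simp add: nf_def)
qed

section \<open>The product of two words\<close>

lemma B_pow_A_pow:
  "B [^] j \<otimes> A [^] a = nf (a + 2 * h * (j * phi a)) (j - 2 * h * (phi j * a))
    (- j * a - 2 * h * (phi (j + 1) * phi a)) (correction j 0 a 0)"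
proof (induction a rule: int_iff_induct)
  case 1 show ?case by (simp add: nf_def correction_def phi_def varphi_def)
next
  case (2 a)
  let ?nf = "\<lambda>a. nf (a + 2 * h * (j * phi a)) (j - 2 * h * (phi j * a))
    (- j * a - 2 * h * (phi (j + 1) * phi a)) (correction j 0 a 0)"
  define H y z where "H = phi (j + 1) * phi a" and "y = j - 2 * h * (phi j * a)"
    and "z = - j * a - 2 * h * H"
  define g K where "g = y - 2 * h * phi y" and "K = phi j * a + phi y"
  have g: "g = j - 2 * h * K" by (simp add: g_def K_def y_def algebra_simps)
  \<comment> \<open>\<open>H\<close> and \<open>K\<close> measure how far \<open>z\<close> and \<open>g\<close> are from \<open>- j * a\<close> and \<open>j\<close>, in units of \<open>2 * h\<close>.\<close>
  have phi_a: "phi (a + 1) = phi a + a" and phi_j: "phi (j + 1) = phi j + j" by (rule phi_Suc)+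
  have phi_y: "phi y = phi j - 2 * h * phi j * a * j + h * phi j * a * (2 * h * phi j * a + 1)"
    using phi_double[of y] phi_double[of j] y_def by algebra
  have step: "?nf a \<otimes> A = ?nf (a + 1)"
    unfolding y_def[symmetric] H_def[symmetric] z_def[symmetric] nf_mult_A g_def[symmetric]
  proof (rule nf_cong)
    show "a + 2 * h * (j * phi a) + 1 - 2 * h * z
        = a + 1 + 2 * h * (j * phi (a + 1)) + 2 * h^2 * (2 * H)"
      unfolding z_def phi_a by algebra
    show "g = j - 2 * h * (phi j * (a + 1)) + 2 * h^2 * (phi j * a * (2 * j - 1 - 2 * h * phi j * a))"
      unfolding g K_def phi_y by algebra
    show "z - y + 2 * h * g * z = - j * (a + 1) - 2 * h * (phi (j + 1) * phi (a + 1))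
        + 2 * h^2 * (2 * (- j * H + K * j * a + 2 * h * K * H))"
      unfolding g z_def y_def H_def phi_a phi_j using phi_double[of j] by algebra
    \<comment> \<open>Modulo \<open>2 * h\<close> the variables \<open>y\<close>, \<open>z\<close>, \<open>g\<close> may be replaced by \<open>j\<close>, \<open>- j * a\<close>, \<open>j\<close>, which
        leaves \<open>correction_step\<close>; the cofactor gathers the differences.\<close>
    show "3 * (correction j 0 a 0 + z * z + z - 2 * varphi (y + 1) - 2 * y * z - z * (g * g - g) + g * z
          + 2 * H - phi j * a * (2 * j - 1 - 2 * h * phi j * a)
          + h * (2 * (- j * H + K * j * a + 2 * h * K * H)) - correction j 0 (a + 1) 0)
      = 2 * h * (3 * (- H * (z - j * a + 1) + 2 * (phi j * a * z + j * H) + H * (g * g - 2 * g)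
          - j * a * K * (g + j - 2)) + phi j * a * (y * y + y * j + j * j - 1)
          + 3 * (phi j * a) * (phi j * a) + 3 * (- j * H + K * j * a + 2 * h * K * H))"
      using correction_step[of j a] varphi_six[of "y + 1"] varphi_six[of "j + 1"]
        y_def z_def g H_def by algebra
  qed
  have "B [^] j \<otimes> A [^] (a + 1) = B [^] j \<otimes> A [^] a \<otimes> A"
    by (simp add: int_pow_mult m_assoc)
  then show ?case unfolding step[symmetric] by simp
qed

text \<open>Moving \<open>C^k\<close> to the right past \<open>A^a\<close> and \<open>B^b\<close> replaces \<open>a\<close> and \<open>b\<close> by \<open>a' = a - 2hka\<close> and
  \<open>b' = b + 2hkb\<close>; then \<open>B_pow_A_pow\<close> applies to \<open>B^j A^a'\<close>, and its power of \<open>C\<close> is moved past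
  \<open>B^b'\<close>. The rest is the re-expansion of the exponents around \<open>a\<close> and \<open>b\<close>.\<close>

lemma collection_formula:
  "(A [^] i \<otimes> B [^] j \<otimes> C [^] k) \<otimes> (A [^] a \<otimes> B [^] b \<otimes> C [^] c) =
    nf (i + a + 2 * h * (j * phi a - k * a))
       (j + b + 2 * h * (k * b - j * a * b - phi j * a))
       (k + c - j * a + 2 * h * (j * k * a - phi (j + 1) * phi a))
       (correction j k a b)"
proof -
  define a' b' where "a' = a - 2 * h * k * a" and "b' = b + 2 * h * k * b"
  define x y z w where "x = a' + 2 * h * (j * phi a')" and "y = j - 2 * h * (phi j * a')"
    and "z = - j * a' - 2 * h * (phi (j + 1) * phi a')" and "w = correction j 0 a' 0"
  have "(A [^] i \<otimes> B [^] j \<otimes> C [^] k) \<otimes> (A [^] a \<otimes> B [^] b \<otimes> C [^] c)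
      = A [^] i \<otimes> B [^] j \<otimes> (C [^] k \<otimes> A [^] a) \<otimes> B [^] b \<otimes> C [^] c"
    by (simp add: m_assoc)
  also have "\<dots> = A [^] i \<otimes> (B [^] j \<otimes> A [^] a') \<otimes> (C [^] k \<otimes> B [^] b) \<otimes> C [^] c
      \<otimes> zeta ((k * k + k) * a)"
    unfolding C_A_collect a'_def[symmetric] by (simp add: m_assoc zeta_moves)
  also have "\<dots> = (A [^] i \<otimes> A [^] x) \<otimes> B [^] y \<otimes> (C [^] z \<otimes> B [^] b') \<otimes> (C [^] k \<otimes> C [^] c)
      \<otimes> zeta (w + ((k - k * k) * b + (k * k + k) * a))"
    unfolding C_B_collect[of k b] b'_def[symmetric] B_pow_A_pow x_def[symmetric] y_def[symmetric]
      z_def[symmetric] w_def[symmetric]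
    by (simp only: nf_def m_assoc zeta_moves add.assoc int_pow_closed A_closed B_closed C_closed
        zeta_closed m_closed)
  also have "\<dots> = (A [^] i \<otimes> A [^] x) \<otimes> (B [^] y \<otimes> B [^] (b' + 2 * h * z * b'))
      \<otimes> (C [^] z \<otimes> C [^] k \<otimes> C [^] c)
      \<otimes> zeta ((z - z * z) * b' + (w + ((k - k * k) * b + (k * k + k) * a)))"
    unfolding C_B_collect
    by (simp only: m_assoc zeta_moves int_pow_closed A_closed B_closed C_closed
        zeta_closed m_closed)
  also have "\<dots> = nf (i + x) (y + (b' + 2 * h * z * b')) (z + k + c)
      ((z - z * z) * b' + (w + ((k - k * k) * b + (k * k + k) * a)))"
    by (simp add: nf_def int_pow_merge)
  also have "\<dots> = nf (i + a + 2 * h * (j * phi a - k * a))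
       (j + b + 2 * h * (k * b - j * a * b - phi j * a))
       (k + c - j * a + 2 * h * (j * k * a - phi (j + 1) * phi a))
       (correction j k a b)"
  proof -
    define S where "S = k * a * (1 - 2 * a + 2 * h * k * a)"
    define K where "K = j * k * a - phi (j + 1) * phi a'"
    have phi_a': "phi a' = phi a + h * S"
      using phi_double[of a'] phi_double[of a] a'_def S_def by algebra
    have phi_j: "phi (j + 1) = phi j + j" by (rule phi_Suc)
    have z: "z = - j * a + 2 * h * K" unfolding z_def K_def a'_def by algebra
    \<comment> \<open>\<open>D\<close> is the cofactor of \<open>2 * h\<close> in the exponent of the central factor. It gathers the change
        of \<open>correction\<close> when \<open>a'\<close> is replaced by \<open>a\<close>, the change of \<open>(z - z * z) * b'\<close> when \<open>z\<close> and
        \<open>b'\<close> are replaced by \<open>- j * a\<close> and \<open>b\<close>, and the higher-order parts of the carries. The carry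
        from \<open>C\<close> has weight \<open>h\<close> only; it becomes even together with the terms \<open>h * S\<close> that \<open>phi a'\<close>
        brings into \<open>correction\<close>.\<close>
    define D where "D = 3 * (- 2 * phi j * phi a * k * a + 2 * phi j * k * a * (j - 1)
      - 2 * j * k * a * phi a - varphi j * k * a * (3 * a' + 3 * a + 1)
      + S * (phi j * (a' + 2 - j) - j + j * a')
      - K * (z - j * a - 1) * b - (z * z - z) * k * b + j * (k * a) * (k * a)
      - 2 * K * b * k + b * phi (j + 1) * S)
      + j * k * a * (a' * a' + a' * a + a * a - 1)"
    show ?thesis
    proof (rule nf_cong)
      show "i + x = i + a + 2 * h * (j * phi a - k * a) + 2 * h^2 * (j * S)"
        unfolding x_def phi_a' unfolding a'_def by algebra
      show "y + (b' + 2 * h * z * b') = j + b + 2 * h * (k * b - j * a * b - phi j * a)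
          + 2 * h^2 * (2 * (phi j * k * a - j * a * k * b + K * b * (1 + 2 * h * k)))"
        unfolding y_def b'_def z a'_def by algebra
      show "z + k + c = k + c - j * a + 2 * h * (j * k * a - phi (j + 1) * phi a)
          + 2 * h^2 * (- phi (j + 1) * S)"
        unfolding z K_def phi_a' by algebra
      have w_diff: "3 * (w - correction j 0 a 0) = 3 * (phi j * (h * S * (- 2 * j + 2 * a' + 5)
            + 2 * phi a * (a' - a)) - 2 * phi j * (a' - a) * (j - 1)
            - j * (h * S * (1 - 2 * a') - 2 * (a' - a) * phi a)
            + varphi j * (a' - a) * (3 * a' + 3 * a + 1))
          - j * (a' - a) * (a' * a' + a' * a + a * a - 1)"
        using varphi_six[of "a' + 1"] varphi_six[of "a + 1"]
        unfolding w_def correction_def phi_a' phi_zero by algebra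
      show "3 * ((z - z * z) * b' + (w + ((k - k * k) * b + (k * k + k) * a)) + j * S
            - 2 * (phi j * k * a - j * a * k * b + K * b * (1 + 2 * h * k))
            + h * (- phi (j + 1) * S) - correction j k a b) = 2 * h * D"
        using w_diff correction_split[of j k a b] z b'_def a'_def S_def K_def phi_a' phi_j
        unfolding D_def by algebra
    qed
  qed
  finally show ?thesis .
qed

end

section \<open>The group of the presentation\<close>

lemma macdonald_pair_J:
  fixes m :: nat and l s :: int
  assumes "m \<ge> 1" and s: "s = 2 ^ (m - 1)"
  shows "macdonald_pair (J_group m l) (J_A m l) (J_B m l)
    (comm (J_group m l) (J_A m l) (J_B m l)) (s * l) (2 ^ (3 * m - 1))"
proof -
  define J A B where "J = J_group m l" and "A = J_A m l" and "B = J_B m l"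
  define C where "C = comm J A B"
  interpret group J unfolding J_def by (rule group_J_group)
  have [simp]: "A \<in> carrier J" "B \<in> carrier J" by (simp_all add: A_def B_def J_def)
  then have [simp]: "C \<in> carrier J" by (simp add: C_def comm_closed)
  have "(2::int) ^ m = 2 * s" using assms(1) s by (metis power_minus_mult mult.commute less_eq_Suc_le One_nat_def)
  then have alpha: "alpha m l = 1 + 2 * (s * l)" by (simp add: alpha_def)
  have order: "(2::int) ^ (3 * m - 1) = 4 * s ^ 3"
  proof -
    have "3 * m - 1 = 2 + (m - 1) * 3" using assms(1) by simp
    then show ?thesis by (simp add: s power_add power_mult)
  qed
  have C_inv: "comm J B A = inv\<^bsub>J\<^esub> C" by (simp add: C_def comm_def inv_mult_group m_assoc)
  have "A \<otimes>\<^bsub>J\<^esub> C = C \<otimes>\<^bsub>J\<^esub> (inv\<^bsub>J\<^esub> C \<otimes>\<^bsub>J\<^esub> A \<otimes>\<^bsub>J\<^esub> C)"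
    by (simp flip: m_assoc)
  also have "inv\<^bsub>J\<^esub> C \<otimes>\<^bsub>J\<^esub> A \<otimes>\<^bsub>J\<^esub> C = A [^]\<^bsub>J\<^esub> (1 + 2 * (s * l))"
    using J_relations(1)[of m l] by (simp add: conj_by_def C_def J_def A_def B_def alpha)
  finally have AC: "A \<otimes>\<^bsub>J\<^esub> C = C \<otimes>\<^bsub>J\<^esub> A [^]\<^bsub>J\<^esub> (1 + 2 * (s * l))" .
  have "C \<otimes>\<^bsub>J\<^esub> B = (C \<otimes>\<^bsub>J\<^esub> B \<otimes>\<^bsub>J\<^esub> inv\<^bsub>J\<^esub> C) \<otimes>\<^bsub>J\<^esub> C"
    by (simp add: m_assoc)
  also have "C \<otimes>\<^bsub>J\<^esub> B \<otimes>\<^bsub>J\<^esub> inv\<^bsub>J\<^esub> C = conj_by J B (comm J B A)"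
    by (simp add: conj_by_def C_inv)
  also have "\<dots> = B [^]\<^bsub>J\<^esub> (1 + 2 * (s * l))"
    using J_relations(2)[of m l] by (simp add: J_def A_def B_def alpha)
  finally have CB: "C \<otimes>\<^bsub>J\<^esub> B = B [^]\<^bsub>J\<^esub> (1 + 2 * (s * l)) \<otimes>\<^bsub>J\<^esub> C" .
  have AB: "A \<otimes>\<^bsub>J\<^esub> B = B \<otimes>\<^bsub>J\<^esub> A \<otimes>\<^bsub>J\<^esub> C"
    by (simp add: C_def comm_def flip: m_assoc) (simp add: m_assoc)
  have N: "A [^]\<^bsub>J\<^esub> ((2::int) ^ (3 * m - 1)) = \<one>\<^bsub>J\<^esub>" "B [^]\<^bsub>J\<^esub> ((2::int) ^ (3 * m - 1)) = \<one>\<^bsub>J\<^esub>"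
    using J_relations(3,4)[of m l] int_pow_int[of J A "2 ^ (3 * m - 1)"]
      int_pow_int[of J B "2 ^ (3 * m - 1)"]
    by (simp_all add: J_def A_def B_def)
  have dvd: "(2::int) ^ (3 * m - 1) dvd 4 * (s * l) ^ 3"
    unfolding order by (simp add: power_mult_distrib)
  have coprime: "coprime ((2::int) ^ (3 * m - 1)) 3"
    by (simp add: coprime_power_left_iff)
  have odd: "(2::int) ^ (3 * m - 1) dvd 4" if "odd (s * l)"
  proof -
    have "m - 1 = 0" using that s by (metis even_mult_iff even_power even_numeral not_gr_zero)
    then show ?thesis using order s by simp
  qed
  have "macdonald_pair J A B C (s * l) (2 ^ (3 * m - 1))"
    by unfold_locales (simp, simp, simp, fact AC, fact CB, fact AB, fact N(1), fact N(2), fact dvd, fact coprime,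
        erule odd)
  then show ?thesis by (simp add: J_def A_def B_def C_def)
qed

theorem theorem3p2:
  fixes m :: nat and l s u i j k a b c eA eB eC :: int
    and J :: "gen word set set monoid" and A B C :: "gen word set set"
  assumes "m \<ge> 1" and "odd l"
    and "s = 2 ^ (m - 1)" and "u = s ^ 2"
    and "J = J_group m l" and "A = J_A m l" and "B = J_B m l" and "C = comm J A B"
    and "eA = i + a + 2 * s * l * (j * phi a - k * a)"
    and "eB = j + b + 2 * s * l * (k * b - j * a * b - phi j * a)"
    and "eC = k + c - j * a + 2 * s * l * (j * k * a - phi (j + 1) * phi a)"
  shows "(A [^]\<^bsub>J\<^esub> i \<otimes>\<^bsub>J\<^esub> B [^]\<^bsub>J\<^esub> j \<otimes>\<^bsub>J\<^esub> C [^]\<^bsub>J\<^esub> k) \<otimes>\<^bsub>J\<^esub>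
         (A [^]\<^bsub>J\<^esub> a \<otimes>\<^bsub>J\<^esub> B [^]\<^bsub>J\<^esub> b \<otimes>\<^bsub>J\<^esub> C [^]\<^bsub>J\<^esub> c) =
         A [^]\<^bsub>J\<^esub> eA \<otimes>\<^bsub>J\<^esub> B [^]\<^bsub>J\<^esub> eB \<otimes>\<^bsub>J\<^esub> C [^]\<^bsub>J\<^esub> eC \<otimes>\<^bsub>J\<^esub>
         A [^]\<^bsub>J\<^esub> xi2 u l j k a b"
proof -
  interpret macdonald_pair J A B C "s * l" "2 ^ (3 * m - 1)"
    unfolding assms(5-8) by (rule macdonald_pair_J) (use assms(1-3) in auto)
  have "xi2 u l j k a b = 2 * (s * l)^2 * correction j k a b"
    by (simp add: xi2_def correction_def assms(4) power_mult_distrib)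
  then show ?thesis
    using collection_formula[of i j k a b c]
    by (simp add: nf_def zeta_def assms(9-11) mult.assoc)
qed

end
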